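(* Let $H$ be a quasi-Hopf $*$-algebra over $\mathbb{C}$ with $*$-canonical element $\Omega$, and define $\tilde S(a)=(S^{-1}(a^\dagger))^\dagger$ for $a\in H$. There exists a unique invertible $w\in H$ such that (i) $w\,S^{-1}(\beta)^\dagger=\alpha_\Omega$ and $\beta_\Omega\,w=S^{-1}(\alpha)^\dagger$; (ii) $S(a)=w\,\tilde S(a)\,w^{-1}$ for all $a\in H$. Explicitly (summation over repeated indices), $$w=S(\bar X_\nu^\dagger)\,\alpha_\Omega\,\bar Y_\nu^\dagger\,S^{-1}(\alpha)^\dagger\,\tilde S(\bar Z_\nu^\dagger)=S(\tilde S^{-1}(X_\nu^\dagger))\,S(\tilde S^{-1}[S^{-1}(\alpha)^\dagger])\,S(Y_\nu^\dagger)\,\alpha_\Omega\,Z_\nu^\dagger,$$ $$w^{-1}=\tilde S(\bar X_\nu^\dagger)\,S^{-1}(\beta)^\dagger\,\bar Y_\nu^\dagger\,\beta_\Omega\,S(\bar Z_\nu^\dagger)=X_\nu^\dagger\,\beta_\Omega\,S(Y_\nu^\dagger)\,S(\tilde S^{-1}[S^{-1}(\beta)^\dagger])\,S(\tilde S^{-1}(Z_\nu^\dagger)).$$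
   Context: Base field $\mathbb{C}$; $1$ also denotes the identity map; $m$ is multiplication. A conjugation operation on an algebra $H$ is an antilinear map $\dagger:H\to H$ with $(a^\dagger)^\dagger=a$, $(ab)^\dagger=b^\dagger a^\dagger$; it is extended to tensor powers by $(a\otimes b)^\dagger=a^\dagger\otimes b^\dagger$, etc. $S^{-1}(\beta)^\dagger$ means $(S^{-1}(\beta))^\dagger$. A quasi-Hopf algebra (QHA) is a unital associative algebra $H$ with algebra homomorphisms $\varepsilon:H\to\mathbb{C}$, $\Delta:H\to H\otimes H$, an invertible $\Phi\in H^{\otimes3}$ (co-associator; write $\Phi=\sum_\nu X_\nu\otimes Y_\nu\otimes Z_\nu$, $\Phi^{-1}=\sum_\nu\bar X_\nu\otimes\bar Y_\nu\otimes\bar Z_\nu$), a bijective algebra anti-homomorphism $S:H\to H$ and $\alpha,\beta\in H$ such that: $(\varepsilon\otimes1)\Delta=1=(1\otimes\varepsilon)\Delta$; $(1\otimes\Delta)\Delta(a)=\Phi^{-1}(\Delta\otimes1)\Delta(a)\Phi$; $(\Delta\otimes1\otimes1)\Phi\cdot(1\otimes1\otimes\Delta)\Phi=(\Phi\otimes1)\cdot(1\otimes\Delta\otimes1)\Phi\cdot(1\otimes\Phi)$; $(1\otimes\varepsilon\otimes1)\Phi=1$; $\sum_\nu S(X_\nu)\alpha Y_\nu\beta S(Z_\nu)=1=\sum_\nu\bar X_\nu\beta S(\bar Y_\nu)\alpha\bar Z_\nu$; $\sum S(a_{(1)})\alpha a_{(2)}=\varepsilon(a)\alpha$ and $\sum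 a_{(1)}\beta S(a_{(2)})=\varepsilon(a)\beta$ for all $a$. A twist is an invertible $F\in H\otimes H$ with $(\varepsilon\otimes1)F=(1\otimes\varepsilon)F=1$. For a twist $F$: $\Phi_F=(F\otimes1)(\Delta\otimes1)(F)\,\Phi\,(1\otimes\Delta)(F^{-1})(1\otimes F^{-1})$, $\alpha_F=m(1\otimes\alpha)(S\otimes1)F^{-1}$, $\beta_F=m(1\otimes\beta)(1\otimes S)F$. A quasi-Hopf $*$-algebra is a QHA $H$ with a conjugation operation $\dagger$ and a twist $\Omega$ (the $*$-canonical element) with $\varepsilon(a^\dagger)=\overline{\varepsilon(a)}$, $\Delta(a)^\dagger=\Omega\Delta(a^\dagger)\Omega^{-1}$ for all $a$, and $(\Phi^\dagger)^{-1}=\Phi_\Omega$. *)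

theory Defs
  imports Complex_Main "HOL-Library.Multiset"
begin

class scaleC =
  fixes scaleC :: "complex \<Rightarrow> 'a \<Rightarrow> 'a" (infixr \<open>*\<^sub>C\<close> 75)

class complex_vector = scaleC + ab_group_add +
  assumes scaleC_add_right: "c *\<^sub>C (x + y) = c *\<^sub>C x + c *\<^sub>C y"
    and scaleC_add_left: "(c + d) *\<^sub>C x = c *\<^sub>C x + d *\<^sub>C x"
    and scaleC_scaleC: "c *\<^sub>C d *\<^sub>C x = (c * d) *\<^sub>C x"
    and scaleC_one: "1 *\<^sub>C x = x"

text \<open>The class \<open>ring_1\<close> contains \<open>0 \<noteq> 1\<close>. This is no restriction below, where every algebra
  carries a counit, i.e. a unital homomorphism to the complex numbers.\<close>

class complex_algebra_1 = complex_vector + ring_1 +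
  assumes mult_scaleC_left: "(c *\<^sub>C x) * y = c *\<^sub>C (x * y)"
    and mult_scaleC_right: "x * (c *\<^sub>C y) = c *\<^sub>C (x * y)"

instantiation complex :: complex_algebra_1
begin
definition scaleC_complex :: "complex \<Rightarrow> complex \<Rightarrow> complex" where
  "scaleC_complex = (*)"
instance
  by standard (simp_all add: scaleC_complex_def algebra_simps)
end

interpretation complex_vector: vector_space "scaleC :: complex \<Rightarrow> 'a::complex_vector \<Rightarrow> 'a"
  by standard (simp_all add: scaleC_add_right scaleC_add_left scaleC_scaleC scaleC_one)

abbreviation clinear :: "('a::complex_vector \<Rightarrow> 'b::complex_vector) \<Rightarrow> bool" where
  "clinear \<equiv> Vector_Spaces.linear scaleC scaleC"

lemma clinearI:
  assumes "\<And>x y. f (x + y) = f x + f y" "\<And>c x. f (c *\<^sub>C x) = c *\<^sub>C f x"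
  shows "clinear f"
  using assms by unfold_locales

lemma clinear_add: "clinear f \<Longrightarrow> f (x + y) = f x + f y"
  and clinear_scaleC: "clinear f \<Longrightarrow> f (c *\<^sub>C x) = c *\<^sub>C f x"
  by (simp_all add: Vector_Spaces.linear_iff)

definition antilinear :: "('a::complex_vector \<Rightarrow> 'b::complex_vector) \<Rightarrow> bool" where
  "antilinear f \<longleftrightarrow> (\<forall>x y. f (x + y) = f x + f y) \<and> (\<forall>c x. f (c *\<^sub>C x) = cnj c *\<^sub>C f x)"

definition algebra_hom :: "('a::complex_algebra_1 \<Rightarrow> 'b::complex_algebra_1) \<Rightarrow> bool" where
  "algebra_hom f \<longleftrightarrow> clinear f \<and> f 1 = 1 \<and> (\<forall>x y. f (x * y) = f x * f y)"

definition algebra_antihom :: "('a::complex_algebra_1 \<Rightarrow> 'b::complex_algebra_1) \<Rightarrow> bool" where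
  "algebra_antihom f \<longleftrightarrow> clinear f \<and> f 1 = 1 \<and> (\<forall>x y. f (x * y) = f y * f x)"

definition has_inverse :: "'a::monoid_mult \<Rightarrow> bool" where
  "has_inverse x \<longleftrightarrow> (\<exists>y. x * y = 1 \<and> y * x = 1)"

definition inverse_of :: "'a::monoid_mult \<Rightarrow> 'a" where
  "inverse_of x = (THE y. x * y = 1 \<and> y * x = 1)"

lemma inverse_of_eqI: "x * y = 1 \<Longrightarrow> y * x = 1 \<Longrightarrow> inverse_of x = (y::'a::monoid_mult)"
  unfolding inverse_of_def by (rule the_equality) (simp, metis mult.assoc mult_1_left mult_1_right)

lemma has_inverse:
  assumes "has_inverse (x::'a::monoid_mult)"
  shows "x * inverse_of x = 1" "inverse_of x * x = 1"
  using assms inverse_of_eqI unfolding has_inverse_def by metis+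

text \<open>A multiset of pairs stands for the formal sum of the corresponding pure tensors. The tensor
  product is the quotient of the additive monoid of formal sums by the congruence that makes
  \<open>(a, b)\<close> bilinear; the universal property is shown below.\<close>

inductive tensor_eq ::
  "('a::complex_vector \<times> 'b::complex_vector) multiset \<Rightarrow> ('a \<times> 'b) multiset \<Rightarrow> bool" where
  refl: "tensor_eq M M"
| sym: "tensor_eq M N \<Longrightarrow> tensor_eq N M"
| trans: "tensor_eq M N \<Longrightarrow> tensor_eq N P \<Longrightarrow> tensor_eq M P"
| cong: "tensor_eq M M' \<Longrightarrow> tensor_eq N N' \<Longrightarrow> tensor_eq (M + N) (M' + N')"
| zero: "tensor_eq {#(0, b)#} {#}"
| add_left: "tensor_eq {#(a + a', b)#} {#(a, b), (a', b)#}"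
| add_right: "tensor_eq {#(a, b + b')#} {#(a, b), (a, b')#}"
| scale: "tensor_eq {#(c *\<^sub>C a, b)#} {#(a, c *\<^sub>C b)#}"

quotient_type (overloaded) ('a, 'b) tensor (infixr \<open>\<otimes>\<close> 75) =
  "('a::complex_vector \<times> 'b::complex_vector) multiset" / tensor_eq
  by (rule equivpI)
    (auto intro!: reflpI sympI transpI intro: tensor_eq.refl tensor_eq.sym tensor_eq.trans)

definition pure_tensor :: "'a::complex_vector \<Rightarrow> 'b::complex_vector \<Rightarrow> 'a \<otimes> 'b" (infixr \<open>\<otimes>\<close> 75)
  where "a \<otimes> b = abs_tensor {#(a, b)#}"

text \<open>The value \<open>\<Sum>\<^sub>i f a\<^sub>i b\<^sub>i\<close> at \<open>\<Sum>\<^sub>i a\<^sub>i \<otimes> b\<^sub>i\<close>. It is independent of the presentation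
  chosen by \<open>rep_tensor\<close> if \<open>f\<close> is biadditive and balanced over the complex numbers; this
  covers bilinear maps as well as maps that are antilinear in both arguments.\<close>

definition tensor_lift ::
  "('a::complex_vector \<Rightarrow> 'b::complex_vector \<Rightarrow> 'c::ab_group_add) \<Rightarrow> 'a \<otimes> 'b \<Rightarrow> 'c" where
  "tensor_lift f t = (\<Sum>(a, b) \<in># rep_tensor t. f a b)"

definition balanced ::
  "('a::complex_vector \<Rightarrow> 'b::complex_vector \<Rightarrow> 'c::ab_group_add) \<Rightarrow> bool" where
  "balanced f \<longleftrightarrow> (\<forall>a a' b. f (a + a') b = f a b + f a' b) \<and>
    (\<forall>a b b'. f a (b + b') = f a b + f a b') \<and> (\<forall>c a b. f (c *\<^sub>C a) b = f a (c *\<^sub>C b))"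

lemma balancedI:
  assumes "\<And>a a' b. f (a + a') b = f a b + f a' b" "\<And>a b b'. f a (b + b') = f a b + f a b'"
    "\<And>c a b. f (c *\<^sub>C a) b = f a (c *\<^sub>C b)"
  shows "balanced f"
  using assms by (simp add: balanced_def)

instantiation tensor :: (complex_vector, complex_vector) complex_vector
begin

lift_definition zero_tensor :: "'a \<otimes> 'b" is "{#}" .

lift_definition plus_tensor :: "'a \<otimes> 'b \<Rightarrow> 'a \<otimes> 'b \<Rightarrow> 'a \<otimes> 'b" is "(+)"
  by (rule tensor_eq.cong)

lift_definition scaleC_tensor :: "complex \<Rightarrow> 'a \<otimes> 'b \<Rightarrow> 'a \<otimes> 'b"
  is "\<lambda>c. image_mset (\<lambda>(a, b). (c *\<^sub>C a, b))"
proof -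
  fix c and M N :: "('a \<times> 'b) multiset"
  assume "tensor_eq M N"
  then show "tensor_eq {#(c *\<^sub>C a, b). (a, b) \<in># M#} {#(c *\<^sub>C a, b). (a, b) \<in># N#}"
  proof induction
    case (scale d a b)
    then show ?case
      using tensor_eq.scale[of d "c *\<^sub>C a" b] by (simp add: mult.commute)
  next
    case (add_left a a' b)
    then show ?case
      using tensor_eq.add_left[of "c *\<^sub>C a" "c *\<^sub>C a'" b] by (simp add: scaleC_add_right)
  qed (auto intro: tensor_eq.intros)
qed

definition uminus_tensor :: "'a \<otimes> 'b \<Rightarrow> 'a \<otimes> 'b" where
  "- t = (- 1) *\<^sub>C t" for t :: "'a \<otimes> 'b"

definition minus_tensor :: "'a \<otimes> 'b \<Rightarrow> 'a \<otimes> 'b \<Rightarrow> 'a \<otimes> 'b" where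
  "s - t = s + - t" for s t :: "'a \<otimes> 'b"

instance
proof
  fix s t u :: "'a \<otimes> 'b" and c d :: complex
  show "s + t + u = s + (t + u)" by transfer (simp add: add.assoc tensor_eq.refl)
  show "s + t = t + s" by transfer (simp add: add.commute tensor_eq.refl)
  show zero: "0 + s = s" by transfer (simp add: tensor_eq.refl)
  show "s - t = s + - t" by (simp add: minus_tensor_def)
  show "c *\<^sub>C (s + t) = c *\<^sub>C s + c *\<^sub>C t" by transfer (simp add: tensor_eq.refl)
  show distrib: "(c + d) *\<^sub>C s = c *\<^sub>C s + d *\<^sub>C s" for c d and s :: "'a \<otimes> 'b"
  proof transfer
    fix c d and M :: "('a \<times> 'b) multiset"
    show "tensor_eq {#((c + d) *\<^sub>C a, b). (a, b) \<in># M#}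
      ({#(c *\<^sub>C a, b). (a, b) \<in># M#} + {#(d *\<^sub>C a, b). (a, b) \<in># M#})"
    proof (induction M)
      case (add x M)
      obtain a b where x: "x = (a, b)" by force
      show ?case
        using tensor_eq.cong[OF tensor_eq.add_left[of "c *\<^sub>C a" "d *\<^sub>C a" b] add.IH]
        by (simp add: x scaleC_add_left add_mset_commute)
    qed (simp add: tensor_eq.refl)
  qed
  show "c *\<^sub>C d *\<^sub>C s = (c * d) *\<^sub>C s"
    by transfer (simp add: tensor_eq.refl image_mset.compositionality comp_def case_prod_unfold)
  show one: "1 *\<^sub>C s = s" for s :: "'a \<otimes> 'b"
    by transfer (simp add: tensor_eq.refl)
  have "0 *\<^sub>C s = 0"
  proof transfer
    fix M :: "('a \<times> 'b) multiset"
    show "tensor_eq {#(0 *\<^sub>C a, b). (a, b) \<in># M#} {#}"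
    proof (induction M)
      case (add x M)
      obtain a b where x: "x = (a, b)" by force
      show ?case
        using tensor_eq.cong[OF tensor_eq.zero[of b] add.IH] by (simp add: x)
    qed (simp add: tensor_eq.refl)
  qed
  with distrib[of "- 1" 1 s] one[of s] show "- s + s = 0"
    by (simp add: uminus_tensor_def)
qed

end

lemma abs_tensor_add: "abs_tensor (M + N) = abs_tensor M + abs_tensor N"
  by (simp add: plus_tensor.abs_eq)

lemma pure_tensor_add_left: "(a + a') \<otimes> b = a \<otimes> b + a' \<otimes> b"
  using tensor_eq.add_left[of a a' b]
  by (simp add: pure_tensor_def plus_tensor.abs_eq tensor.abs_eq_iff add_mset_commute)

lemma pure_tensor_add_right: "a \<otimes> (b + b') = a \<otimes> b + a \<otimes> b'"
  using tensor_eq.add_right[of a b b']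
  by (simp add: pure_tensor_def plus_tensor.abs_eq tensor.abs_eq_iff add_mset_commute)

lemma pure_tensor_scaleC_left: "(c *\<^sub>C a) \<otimes> b = c *\<^sub>C (a \<otimes> b)"
  by (simp add: pure_tensor_def scaleC_tensor.abs_eq)

lemma pure_tensor_scaleC_right: "a \<otimes> (c *\<^sub>C b) = c *\<^sub>C (a \<otimes> b)"
  unfolding pure_tensor_scaleC_left[symmetric]
  by (simp add: pure_tensor_def tensor.abs_eq_iff tensor_eq.scale tensor_eq.sym)

lemmas pure_tensor_simps =
  pure_tensor_add_left pure_tensor_add_right pure_tensor_scaleC_left pure_tensor_scaleC_right

lemma tensor_induct [case_names zero add]:
  assumes "P 0" and "\<And>a b t. P t \<Longrightarrow> P (a \<otimes> b + t)"
  shows "P t"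
proof (induction t rule: tensor.abs_induct)
  case (1 M)
  show ?case
  proof (induction M)
    case empty
    then show ?case using assms(1) by (simp add: zero_tensor_def)
  next
    case (add x M)
    then show ?case
      using assms(2)[of "abs_tensor M" "fst x" "snd x"]
      by (simp add: pure_tensor_def plus_tensor.abs_eq)
  qed
qed

lemma tensor_lift_abs:
  assumes f: "balanced f"
  shows "tensor_lift f (abs_tensor M) = (\<Sum>(a, b) \<in># M. f a b)"
proof -
  have z: "f 0 b = 0" for b
    using f unfolding balanced_def by (metis add.right_neutral add_left_cancel)
  have "tensor_eq M N \<Longrightarrow> (\<Sum>(a, b) \<in># M. f a b) = (\<Sum>(a, b) \<in># N. f a b)" for M N
    by (induction rule: tensor_eq.induct) (use f z in \<open>simp_all add: balanced_def\<close>)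
  then show ?thesis
      unfolding tensor_lift_def using Quotient_rep_abs[OF Quotient_tensor] tensor_eq.refl by metis
qed

lemma tensor_lift_pure: "balanced f \<Longrightarrow> tensor_lift f (a \<otimes> b) = f a b"
  by (simp add: pure_tensor_def tensor_lift_abs)

lemma tensor_lift_zero: "balanced f \<Longrightarrow> tensor_lift f 0 = 0"
  by (simp add: zero_tensor_def tensor_lift_abs)

lemma tensor_lift_add:
  assumes "balanced f"
  shows "tensor_lift f (s + t) = tensor_lift f s + tensor_lift f t"
proof (induction s rule: tensor.abs_induct, induction t rule: tensor.abs_induct)
  case (1 M N)
  then show ?case by (simp add: plus_tensor.abs_eq tensor_lift_abs assms)
qed

lemma tensor_lift_sum:
  "balanced f \<Longrightarrow> tensor_lift f (\<Sum>i\<in>I. a i \<otimes> b i) = (\<Sum>i\<in>I. f (a i) (b i))"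
  by (induction I rule: infinite_finite_induct)
    (simp_all add: tensor_lift_zero tensor_lift_add tensor_lift_pure)

lemma tensor_lift_scaleC:
  fixes f :: "'a::complex_vector \<Rightarrow> 'b::complex_vector \<Rightarrow> 'c::complex_vector"
  assumes f: "balanced f" and c: "\<And>a b. f (c *\<^sub>C a) b = d *\<^sub>C f a b"
  shows "tensor_lift f (c *\<^sub>C t) = d *\<^sub>C tensor_lift f t"
  by (induction t rule: tensor_induct)
    (simp_all add: tensor_lift_add[OF f] tensor_lift_zero[OF f] scaleC_add_right
      pure_tensor_scaleC_left[symmetric] tensor_lift_pure[OF f] c)

lemma tensor_lift_weak_cong: "s = t \<Longrightarrow> tensor_lift f s = tensor_lift f t"
  by simp

lemma additive_tensor_eqI:
  fixes F G :: "'a::complex_vector \<otimes> 'b::complex_vector \<Rightarrow> 'c::ab_group_add"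
  assumes "\<And>s t. F (s + t) = F s + F t" "\<And>s t. G (s + t) = G s + G t"
    and "\<And>a b. F (a \<otimes> b) = G (a \<otimes> b)"
  shows "F t = G t"
proof (induction t rule: tensor_induct)
  case zero
  have "F 0 = 0" "G 0 = 0"
    using assms(1,2) by (metis add.right_neutral add_left_cancel)+
  then show ?case by simp
qed (simp add: assms)

theorem tensor_universal_property:
  fixes f :: "'a::complex_vector \<Rightarrow> 'b::complex_vector \<Rightarrow> 'c::complex_vector"
  assumes "\<And>a. clinear (f a)" and "\<And>b. clinear (\<lambda>a. f a b)"
  shows "\<exists>!F. clinear F \<and> (\<forall>a b. F (a \<otimes> b) = f a b)"
proof
  have f: "balanced f"
    using assms by (intro balancedI) (simp_all add: Vector_Spaces.linear_iff)
  show "clinear (tensor_lift f) \<and> (\<forall>a b. tensor_lift f (a \<otimes> b) = f a b)"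
    using f assms
    by (auto intro!: clinearI tensor_lift_scaleC
        simp: tensor_lift_add tensor_lift_pure clinear_scaleC[OF assms(2)])
  fix F assume F: "clinear F \<and> (\<forall>a b. F (a \<otimes> b) = f a b)"
  show "F = tensor_lift f"
  proof
    fix t
    show "F t = tensor_lift f t"
      by (rule additive_tensor_eqI[of F])
        (use F f in \<open>auto simp: tensor_lift_add tensor_lift_pure clinear_add\<close>)
  qed
qed

lemma balanced_pure_tensor: "balanced (\<lambda>a b. (f a :: 'c::complex_vector) \<otimes> (g b :: 'd::complex_vector))"
  if "clinear f" "clinear g"
  using that by (intro balancedI) (simp_all add: Vector_Spaces.linear_iff pure_tensor_simps)

lemma ex_functional:
  assumes "(x :: 'a::complex_vector) \<noteq> 0"
  shows "\<exists>f :: 'a \<Rightarrow> complex. clinear f \<and> f x = 1"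
proof -
  interpret vector_space_pair
    "scaleC :: complex \<Rightarrow> 'a \<Rightarrow> 'a" "scaleC :: complex \<Rightarrow> complex \<Rightarrow> complex"
    by unfold_locales
  have "complex_vector.independent {x}" using assms by simp
  then show ?thesis
    using linear_construct construct_basis[of "{x}" x "\<lambda>_. 1"] by blast
qed

instantiation tensor :: (complex_algebra_1, complex_algebra_1) complex_algebra_1
begin

definition one_tensor :: "'a \<otimes> 'b" where "1 = (1 :: 'a) \<otimes> (1 :: 'b)"

definition times_tensor :: "'a \<otimes> 'b \<Rightarrow> 'a \<otimes> 'b \<Rightarrow> 'a \<otimes> 'b" where
  "s * t = tensor_lift (\<lambda>a b. tensor_lift (\<lambda>a' b'. (a * a') \<otimes> (b * b')) t) s" for s t :: "'a \<otimes> 'b"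

lemma balanced_mult_pure: "balanced (\<lambda>a' b'. (a * a') \<otimes> (b * b'))" for a :: 'a and b :: 'b
  by (intro balancedI) (simp_all add: pure_tensor_simps distrib_left mult_scaleC_right)

lemma balanced_mult_lift: "balanced (\<lambda>a b. tensor_lift (\<lambda>a' b'. (a * a') \<otimes> (b * b')) t)"
  for t :: "'a \<otimes> 'b"
proof (rule balancedI)
  fix a a' :: 'a and b b' :: 'b and c
  let ?L = "\<lambda>a b. tensor_lift (\<lambda>a' b'. (a * a') \<otimes> (b * b')) t"
  show "?L (a + a') b = ?L a b + ?L a' b"
    by (rule additive_tensor_eqI[of "tensor_lift _"])
      (simp_all add: tensor_lift_add[OF balanced_mult_pure]
        tensor_lift_pure[OF balanced_mult_pure] pure_tensor_simps distrib_right
        cong: tensor_lift_weak_cong)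
  show "?L a (b + b') = ?L a b + ?L a b'"
    by (rule additive_tensor_eqI[of "tensor_lift _"])
      (simp_all add: tensor_lift_add[OF balanced_mult_pure]
        tensor_lift_pure[OF balanced_mult_pure] pure_tensor_simps distrib_right
        cong: tensor_lift_weak_cong)
  show "?L (c *\<^sub>C a) b = ?L a (c *\<^sub>C b)"
    by (rule additive_tensor_eqI[of "tensor_lift _"])
      (simp_all add: tensor_lift_add[OF balanced_mult_pure]
        tensor_lift_pure[OF balanced_mult_pure] pure_tensor_simps mult_scaleC_left
        cong: tensor_lift_weak_cong)
qed

lemma tensor_mult_pure: "(a \<otimes> b) * (a' \<otimes> b') = (a * a') \<otimes> (b * b')"
  for a a' :: 'a and b b' :: 'b
  by (simp add: times_tensor_def tensor_lift_pure[OF balanced_mult_lift]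
      tensor_lift_pure[OF balanced_mult_pure]
      cong: tensor_lift_weak_cong)

lemma times_left: "(s + t) * u = s * u + t * u"
  for s t u :: "'a \<otimes> 'b"
  by (simp add: times_tensor_def tensor_lift_add balanced_mult_lift)

lemma times_right: "s * (t + u) = s * t + s * u"
  for s t u :: "'a \<otimes> 'b"
proof (rule additive_tensor_eqI[of "\<lambda>s. s * (t + u)"])
  fix a :: 'a and b :: 'b
  show "(a \<otimes> b) * (t + u) = (a \<otimes> b) * t + (a \<otimes> b) * u"
    by (simp add: times_tensor_def tensor_lift_pure[OF balanced_mult_lift]
        tensor_lift_add[OF balanced_mult_pure] cong: tensor_lift_weak_cong)
qed (simp_all add: times_left)

instance
proof
  fix s t u :: "'a \<otimes> 'b" and c :: complex
  show "(s + t) * u = s * u + t * u" by (rule times_left)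
  show "s * (t + u) = s * t + s * u" by (rule times_right)
  show "1 * s = s"
    by (rule additive_tensor_eqI[of "\<lambda>s. 1 * s"])
      (simp_all add: times_right one_tensor_def tensor_mult_pure)
  show "s * 1 = s"
    by (rule additive_tensor_eqI[of "\<lambda>s. s * 1"])
      (simp_all add: times_left one_tensor_def tensor_mult_pure)
  have assoc1: "(a \<otimes> b) * (a' \<otimes> b') * u = (a \<otimes> b) * ((a' \<otimes> b') * u)" for a a' b b'
    by (rule additive_tensor_eqI[of "\<lambda>u. (a \<otimes> b) * (a' \<otimes> b') * u"])
      (simp_all add: times_right tensor_mult_pure mult.assoc)
  have assoc2: "(a \<otimes> b) * t * u = (a \<otimes> b) * (t * u)" for a b
    by (rule additive_tensor_eqI[of "\<lambda>t. (a \<otimes> b) * t * u"])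
      (simp_all add: times_left times_right assoc1)
  show "s * t * u = s * (t * u)"
    by (rule additive_tensor_eqI[of "\<lambda>s. s * t * u"]) (simp_all add: times_left assoc2)
  have scale1: "(c *\<^sub>C (a \<otimes> b)) * t = c *\<^sub>C ((a \<otimes> b) * t)" for a b
    by (rule additive_tensor_eqI[of "\<lambda>t. (c *\<^sub>C (a \<otimes> b)) * t"])
      (simp_all add: times_right tensor_mult_pure scaleC_add_right mult_scaleC_left
        pure_tensor_scaleC_left[symmetric])
  show "(c *\<^sub>C s) * t = c *\<^sub>C (s * t)"
    by (rule additive_tensor_eqI[of "\<lambda>s. (c *\<^sub>C s) * t"])
      (simp_all add: times_left scaleC_add_right scale1)
  have scale2: "(a \<otimes> b) * (c *\<^sub>C t) = c *\<^sub>C ((a \<otimes> b) * t)" for a b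
    by (rule additive_tensor_eqI[of "\<lambda>t. (a \<otimes> b) * (c *\<^sub>C t)"])
      (simp_all add: times_right tensor_mult_pure scaleC_add_right mult_scaleC_right
        pure_tensor_scaleC_left[symmetric])
  show "s * (c *\<^sub>C t) = c *\<^sub>C (s * t)"
    by (rule additive_tensor_eqI[of "\<lambda>s. s * (c *\<^sub>C t)"])
      (simp_all add: times_left scaleC_add_right scale2)
  obtain f :: "'a \<Rightarrow> complex" and g :: "'b \<Rightarrow> complex"
    where f: "clinear f" "f 1 = 1" and g: "clinear g" "g 1 = 1"
    using ex_functional[of "1::'a"] ex_functional[of "1::'b"] by auto
  have fg: "balanced (\<lambda>a b. f a * g b)"
    by (rule balancedI)
      (simp_all add: clinear_add[OF f(1)] clinear_add[OF g(1)] clinear_scaleC[OF f(1)]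
        clinear_scaleC[OF g(1)] scaleC_complex_def algebra_simps)
  show "(0 :: 'a \<otimes> 'b) \<noteq> 1"
    using tensor_lift_zero[OF fg] tensor_lift_pure[OF fg, of 1 1] f g
    by (auto simp: one_tensor_def)
qed

end

text \<open>For linear \<open>f\<close> and \<open>g\<close> this is \<open>f \<otimes> g\<close>; it is also used with \<open>f\<close> and \<open>g\<close> both antilinear.\<close>

definition tensor_map :: "('a::complex_vector \<Rightarrow> 'c::complex_vector) \<Rightarrow>
    ('b::complex_vector \<Rightarrow> 'd::complex_vector) \<Rightarrow> 'a \<otimes> 'b \<Rightarrow> 'c \<otimes> 'd" where
  "tensor_map f g = tensor_lift (\<lambda>a b. f a \<otimes> g b)"

text \<open>Higher tensor powers are nested to the right, \<open>H \<otimes> H \<otimes> H = H \<otimes> (H \<otimes> H)\<close>; the canonical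
  rebracketing \<open>(a \<otimes> b) \<otimes> c \<mapsto> a \<otimes> (b \<otimes> c)\<close> is made explicit.\<close>

definition tensor_assoc ::
  "('a::complex_vector \<otimes> 'b::complex_vector) \<otimes> 'c::complex_vector \<Rightarrow> 'a \<otimes> 'b \<otimes> 'c" where
  "tensor_assoc = tensor_lift (\<lambda>t c. tensor_lift (\<lambda>a b. a \<otimes> b \<otimes> c) t)"

definition mult_map :: "'a::complex_algebra_1 \<otimes> 'a \<Rightarrow> 'a" where
  "mult_map = tensor_lift (*)"

definition tensor_lift3 :: "('a::complex_vector \<Rightarrow> 'b::complex_vector \<Rightarrow> 'c::complex_vector \<Rightarrow>
    'd::ab_group_add) \<Rightarrow> 'a \<otimes> 'b \<otimes> 'c \<Rightarrow> 'd" where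
  "tensor_lift3 f = tensor_lift (\<lambda>a. tensor_lift (f a))"

lemma tensor_lift3_sum:
  assumes f: "\<And>a. balanced (f a)"
    and add: "\<And>a a' b c. f (a + a') b c = f a b c + f a' b c"
    and scale: "\<And>d a b c. f (d *\<^sub>C a) b c = f a (d *\<^sub>C b) c"
  shows "tensor_lift3 f (\<Sum>i\<in>I. X i \<otimes> Y i \<otimes> Z i) = (\<Sum>i\<in>I. f (X i) (Y i) (Z i))"
proof -
  have "balanced (\<lambda>a. tensor_lift (f a))"
  proof (rule balancedI)
    fix a a' t d
    show "tensor_lift (f (a + a')) t = tensor_lift (f a) t + tensor_lift (f a') t"
      by (induction t rule: tensor_induct)
        (simp_all add: tensor_lift_zero[OF f] tensor_lift_add[OF f] tensor_lift_pure[OF f] add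
          cong: tensor_lift_weak_cong)
    show "tensor_lift (f (d *\<^sub>C a)) t = tensor_lift (f a) (d *\<^sub>C t)"
    proof (induction t rule: tensor_induct)
      case zero
      show ?case by (simp add: tensor_lift_zero[OF f])
    next
      case (add b c t)
      have "d *\<^sub>C (b \<otimes> c + t) = (d *\<^sub>C b) \<otimes> c + d *\<^sub>C t"
        by (simp only: scaleC_add_right pure_tensor_scaleC_left)
      then show ?case
        by (simp add: tensor_lift_add[OF f] tensor_lift_pure[OF f] add.IH scale
            cong: tensor_lift_weak_cong)
    qed
  qed (simp only: tensor_lift_add[OF f])
  then show ?thesis
    by (simp add: tensor_lift3_def tensor_lift_sum tensor_lift_pure f)
qed

lemma tensor_map_pure:
  "clinear f \<Longrightarrow> clinear g \<Longrightarrow> tensor_map f g (a \<otimes> b) = f a \<otimes> g b"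
  by (simp add: tensor_map_def tensor_lift_pure balanced_pure_tensor)

lemma tensor_map_pure_antilinear:
  "antilinear f \<Longrightarrow> antilinear g \<Longrightarrow> tensor_map f g (a \<otimes> b) = f a \<otimes> g b"
  unfolding tensor_map_def
  by (intro tensor_lift_pure balancedI) (simp_all add: antilinear_def pure_tensor_simps)

lemma tensor_assoc_pure:
  fixes a :: "'a::complex_vector" and b :: "'b::complex_vector" and c :: "'c::complex_vector"
  shows "tensor_assoc ((a \<otimes> b) \<otimes> c) = a \<otimes> b \<otimes> c"
proof -
  have b1: "balanced (\<lambda>(a::'a) (b::'b). a \<otimes> b \<otimes> c)" for c :: 'c
    by (intro balancedI) (simp_all add: pure_tensor_simps)
  have "balanced (\<lambda>t (c::'c). tensor_lift (\<lambda>(a::'a) (b::'b). a \<otimes> b \<otimes> c) t)"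
  proof (rule balancedI)
    fix t :: "'a \<otimes> 'b" and c c' :: 'c and d
    show "tensor_lift (\<lambda>a b. a \<otimes> b \<otimes> (c + c')) t =
        tensor_lift (\<lambda>a b. a \<otimes> b \<otimes> c) t + tensor_lift (\<lambda>a b. a \<otimes> b \<otimes> c') t"
      by (rule additive_tensor_eqI[of "tensor_lift _"])
        (simp_all add: tensor_lift_add[OF b1] tensor_lift_pure[OF b1] pure_tensor_simps
          cong: tensor_lift_weak_cong)
    show "tensor_lift (\<lambda>a b. a \<otimes> b \<otimes> c) (d *\<^sub>C t) = tensor_lift (\<lambda>a b. a \<otimes> b \<otimes> (d *\<^sub>C c)) t"
      by (rule additive_tensor_eqI[of "\<lambda>t. tensor_lift _ (d *\<^sub>C t)"])
        (simp_all add: tensor_lift_add[OF b1] tensor_lift_pure[OF b1] scaleC_add_right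
          pure_tensor_scaleC_left[symmetric], simp add: pure_tensor_simps)
  qed (simp add: tensor_lift_add b1)
  then show ?thesis by (simp add: tensor_assoc_def tensor_lift_pure b1)
qed

lemma mult_map_pure: "mult_map (a \<otimes> b) = a * b"
  unfolding mult_map_def
  by (intro tensor_lift_pure balancedI)
    (simp_all add: distrib_left distrib_right mult_scaleC_left mult_scaleC_right)

lemma tensor3_decomposition:
  fixes t :: "'a::complex_vector \<otimes> 'b::complex_vector \<otimes> 'c::complex_vector"
  shows "\<exists>(n::nat) X Y Z. t = (\<Sum>i<n. X i \<otimes> Y i \<otimes> Z i)"
proof (induction t rule: tensor_induct)
  case zero
  show ?case by (rule exI[of _ 0]) simp
next
  case (add a s t)
  show ?case
  proof (induction s arbitrary: rule: tensor_induct)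
    case zero
    have "a \<otimes> (0 :: 'b \<otimes> 'c) = 0"
      by (metis add_cancel_right_right pure_tensor_add_right)
    then show ?case using add by simp
  next
    case (add b c s)
    then obtain n :: nat and X Y Z where "a \<otimes> s + t = (\<Sum>i<n. X i \<otimes> Y i \<otimes> Z i)" by blast
    then have "a \<otimes> (b \<otimes> c + s) + t =
        (\<Sum>i<Suc n. (X(n := a)) i \<otimes> (Y(n := b)) i \<otimes> (Z(n := c)) i)"
      by (simp add: pure_tensor_add_right add.commute add.left_commute)
    then show ?case by blast
  qed
qed

text \<open>\<open>\<epsilon> \<otimes> 1\<close> and \<open>1 \<otimes> \<epsilon>\<close>, composed with the identifications of \<open>\<complex> \<otimes> V\<close> and \<open>V \<otimes> \<complex>\<close> with \<open>V\<close>.\<close>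

definition counit_left ::
  "('a::complex_vector \<Rightarrow> complex) \<Rightarrow> 'a \<otimes> 'b::complex_vector \<Rightarrow> 'b" where
  "counit_left \<epsilon> = tensor_lift (\<lambda>a b. \<epsilon> a *\<^sub>C b)"

definition counit_right ::
  "('b::complex_vector \<Rightarrow> complex) \<Rightarrow> 'a::complex_vector \<otimes> 'b \<Rightarrow> 'a" where
  "counit_right \<epsilon> = tensor_lift (\<lambda>a b. \<epsilon> b *\<^sub>C a)"

locale quasi_hopf_algebra =
  fixes \<epsilon> :: "'a::complex_algebra_1 \<Rightarrow> complex"
    and \<Delta> :: "'a \<Rightarrow> 'a \<otimes> 'a"
    and \<Phi> :: "'a \<otimes> 'a \<otimes> 'a"
    and S :: "'a \<Rightarrow> 'a"
    and \<alpha> \<beta> :: 'a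
  assumes counit_hom: "algebra_hom \<epsilon>"
    and comult_hom: "algebra_hom \<Delta>"
    and coassociator_invertible: "has_inverse \<Phi>"
    and antipode_antihom: "algebra_antihom S"
    and antipode_bij: "bij S"
    and counit_comult: "counit_left \<epsilon> (\<Delta> a) = a" "counit_right \<epsilon> (\<Delta> a) = a"
    and quasi_coassoc: "tensor_map id \<Delta> (\<Delta> a) =
      inverse_of \<Phi> * tensor_assoc (tensor_map \<Delta> id (\<Delta> a)) * \<Phi>"
    and pentagon:
      "tensor_assoc (tensor_map \<Delta> id \<Phi>) * tensor_map id (tensor_map id \<Delta>) \<Phi> =
       tensor_map id tensor_assoc (tensor_assoc (\<Phi> \<otimes> 1)) *
       tensor_map id tensor_assoc (tensor_map id (tensor_map \<Delta> id) \<Phi>) *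
       (1 \<otimes> \<Phi>)"
    and counit_coassociator: "tensor_map id (counit_left \<epsilon>) \<Phi> = 1"
    and antipode_coassociator:
      "tensor_lift3 (\<lambda>x y z. S x * \<alpha> * y * \<beta> * S z) \<Phi> = 1"
      "tensor_lift3 (\<lambda>x y z. x * \<beta> * S y * \<alpha> * z) (inverse_of \<Phi>) = 1"
    and antipode_left: "tensor_lift (\<lambda>x y. S x * \<alpha> * y) (\<Delta> a) = \<epsilon> a *\<^sub>C \<alpha>"
    and antipode_right: "tensor_lift (\<lambda>x y. x * \<beta> * S y) (\<Delta> a) = \<epsilon> a *\<^sub>C \<beta>"

definition is_twist :: "('a::complex_algebra_1 \<Rightarrow> complex) \<Rightarrow> 'a \<otimes> 'a \<Rightarrow> bool" where
  "is_twist \<epsilon> F \<longleftrightarrow> has_inverse F \<and> counit_left \<epsilon> F = 1 \<and> counit_right \<epsilon> F = 1"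

definition twist_coassociator ::
  "('a::complex_algebra_1 \<Rightarrow> 'a \<otimes> 'a) \<Rightarrow> 'a \<otimes> 'a \<otimes> 'a \<Rightarrow> 'a \<otimes> 'a \<Rightarrow> 'a \<otimes> 'a \<otimes> 'a" where
  "twist_coassociator \<Delta> \<Phi> F =
    tensor_assoc (F \<otimes> 1) * tensor_assoc (tensor_map \<Delta> id F) * \<Phi> *
    tensor_map id \<Delta> (inverse_of F) * (1 \<otimes> inverse_of F)"

definition twist_alpha ::
  "('a::complex_algebra_1 \<Rightarrow> 'a) \<Rightarrow> 'a \<Rightarrow> 'a \<otimes> 'a \<Rightarrow> 'a" where
  "twist_alpha S \<alpha> F = mult_map ((1 \<otimes> \<alpha>) * tensor_map S id (inverse_of F))"

definition twist_beta ::
  "('a::complex_algebra_1 \<Rightarrow> 'a) \<Rightarrow> 'a \<Rightarrow> 'a \<otimes> 'a \<Rightarrow> 'a" where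
  "twist_beta S \<beta> F = mult_map ((1 \<otimes> \<beta>) * tensor_map id S F)"

definition conjugation :: "('a::complex_algebra_1 \<Rightarrow> 'a) \<Rightarrow> bool" where
  "conjugation dag \<longleftrightarrow>
    antilinear dag \<and> (\<forall>a. dag (dag a) = a) \<and> (\<forall>a b. dag (a * b) = dag b * dag a)"

locale quasi_hopf_star_algebra = quasi_hopf_algebra \<epsilon> \<Delta> \<Phi> S \<alpha> \<beta>
  for \<epsilon> :: "'a::complex_algebra_1 \<Rightarrow> complex" and \<Delta> \<Phi> S \<alpha> \<beta> +
  fixes dag :: "'a \<Rightarrow> 'a"
    and \<Omega> :: "'a \<otimes> 'a"
  assumes conjugation: "conjugation dag"
    and canonical_twist: "is_twist \<epsilon> \<Omega>"
    and counit_dag: "\<epsilon> (dag a) = cnj (\<epsilon> a)"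
    and comult_dag: "tensor_map dag dag (\<Delta> a) = \<Omega> * \<Delta> (dag a) * inverse_of \<Omega>"
    and coassociator_dag:
      "inverse_of (tensor_map dag (tensor_map dag dag) \<Phi>) = twist_coassociator \<Delta> \<Phi> \<Omega>"

definition conj_antipode :: "('a \<Rightarrow> 'a) \<Rightarrow> ('a \<Rightarrow> 'a) \<Rightarrow> 'a \<Rightarrow> 'a" where
  "conj_antipode S dag a = dag (inv S (dag a))"

end

theory Submission
  imports Defs
begin

text \<open>The statement is the uniqueness of the antipode of a quasi-Hopf algebra, applied to two
  antipodes that a star structure puts on one and the same quasi-bialgebra.

  Conjugating \<open>\<Delta>\<close> and the inverse of \<open>\<Phi>\<close> gives a new quasi-bialgebra on \<open>H\<close>
  (\<open>quasi_bialgebra_dag\<close>). Transporting \<open>S\<close> along the conjugation equips it with the antipode data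
  \<open>(St, S\<^sup>-\<^sup>1(\<beta>)\<^sup>\<dagger>, S\<^sup>-\<^sup>1(\<alpha>)\<^sup>\<dagger>)\<close>; see \<open>quasi_antipode_dag\<close>. By the axioms on \<open>\<Omega>\<close> the same
  quasi-bialgebra is the twist of \<open>H\<close> by \<open>\<Omega>\<close>, and twisting keeps \<open>S\<close> while it changes \<open>\<alpha>\<close> and \<open>\<beta>\<close>
  into \<open>\<alpha>\<^sub>\<Omega>\<close> and \<open>\<beta>\<^sub>\<Omega>\<close>; see \<open>quasi_antipode_canonical_twist\<close>. The pentagon for the twisted
  co-associator is thereby obtained from the conjugation, without a computation with twists.

  It remains to compare two antipode data \<open>(S, \<alpha>, \<beta>)\<close> and \<open>(T, \<gamma>, \<delta>)\<close> on a quasi-bialgebra, which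
  is Drinfeld's theorem. The candidate is the mixed triangle \<open>w = S(X) \<alpha> Y \<delta> T(Z)\<close>, summed over the
  co-associator. Quasi-coassociativity gives \<open>S(a) w = w T(a)\<close> (\<open>snake_intertwines\<close>), and the
  pentagon gives \<open>w \<gamma> = \<alpha>\<close> and \<open>\<beta> w = \<delta>\<close> (\<open>snake_eval\<close>, \<open>coeval_snake\<close>). With the roles of the two
  antipodes exchanged the same formula gives the inverse of \<open>w\<close>. Conversely, the triangle identity
  of \<open>S\<close>, multiplied by any \<open>w\<close> with these properties, becomes the formula for \<open>w\<close>
  (\<open>antipode_intertwiner_unique\<close>); the triangle identity for the inverse co-associator yields the
  other pair of formulas (\<open>antipode_intertwiner_cosnake\<close>).\<close>

section \<open>Multilinear maps and tensor powers\<close>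

definition biclinear ::
  "('a::complex_vector \<Rightarrow> 'b::complex_vector \<Rightarrow> 'c::complex_vector) \<Rightarrow> bool" where
  "biclinear f \<longleftrightarrow> (\<forall>a. clinear (f a)) \<and> (\<forall>b. clinear (\<lambda>a. f a b))"

definition triclinear :: "('a::complex_vector \<Rightarrow> 'b::complex_vector \<Rightarrow> 'c::complex_vector \<Rightarrow>
    'd::complex_vector) \<Rightarrow> bool" where
  "triclinear f \<longleftrightarrow> (\<forall>a. biclinear (f a)) \<and> (\<forall>b c. clinear (\<lambda>a. f a b c))"

text \<open>The pentagon is an identity in the fourth tensor power and is evaluated by lifts of this kind.\<close>

definition tensor_lift4 :: "('a::complex_vector \<Rightarrow> 'b::complex_vector \<Rightarrow> 'c::complex_vector \<Rightarrow>
    'd::complex_vector \<Rightarrow> 'e::ab_group_add) \<Rightarrow> 'a \<otimes> 'b \<otimes> 'c \<otimes> 'd \<Rightarrow> 'e" where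
  "tensor_lift4 f = tensor_lift (\<lambda>a. tensor_lift3 (f a))"

lemma clinear_ident [simp]: "clinear id" "clinear (\<lambda>x. x)"
  by (auto intro!: clinearI)

lemma clinear_mult_const [simp]:
  fixes f :: "'a::complex_vector \<Rightarrow> 'b::complex_algebra_1"
  shows "clinear f \<Longrightarrow> clinear (\<lambda>x. c * f x)" "clinear f \<Longrightarrow> clinear (\<lambda>x. f x * c)"
  by (auto intro!: clinearI simp: clinear_add clinear_scaleC distrib_left distrib_right
      mult_scaleC_left mult_scaleC_right)

lemma clinear_compose: "clinear f \<Longrightarrow> clinear g \<Longrightarrow> clinear (\<lambda>x. f (g x))"
  by (auto intro!: clinearI simp: clinear_add clinear_scaleC)

lemma biclinear_balanced: "biclinear f \<Longrightarrow> balanced f"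
  by (auto intro!: balancedI simp: biclinear_def Vector_Spaces.linear_iff)

lemma clinear_tensor_lift: "biclinear f \<Longrightarrow> clinear (tensor_lift f)"
  by (intro clinearI tensor_lift_add tensor_lift_scaleC biclinear_balanced)
    (auto simp: biclinear_def Vector_Spaces.linear_iff)

text \<open>Linearity of a lift in a parameter cannot be read off from the lift itself: it spreads from pure
  tensors along sums. It makes the nested lifts multilinear again.\<close>

lemma clinear_tensor_lift_param:
  assumes "\<And>a. biclinear (f a)" and "\<And>b c. clinear (\<lambda>a. f a b c)"
  shows "clinear (\<lambda>a. tensor_lift (f a) t)"
proof -
  have bal: "balanced (f a)" for a
    by (rule biclinear_balanced) (rule assms)
  show ?thesis
  proof (induction t rule: tensor_induct)
    case zero
    show ?case by (auto intro!: clinearI simp: tensor_lift_zero[OF bal])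
  next
    case (add b c t)
    show ?case
      by (auto intro!: clinearI simp: tensor_lift_add[OF bal] tensor_lift_pure[OF bal]
          clinear_add[OF assms(2)] clinear_scaleC[OF assms(2)] clinear_add[OF add.IH]
          clinear_scaleC[OF add.IH] scaleC_add_right cong: tensor_lift_weak_cong)
  qed
qed

lemma biclinear_tensor_lift:
  assumes "triclinear f"
  shows "biclinear (\<lambda>a. tensor_lift (f a))"
  using assms unfolding triclinear_def
  by (auto simp: biclinear_def[of "\<lambda>a. tensor_lift (f a)"]
      intro!: clinear_tensor_lift clinear_tensor_lift_param)

lemma clinear_tensor_lift3: "triclinear f \<Longrightarrow> clinear (tensor_lift3 f)"
  unfolding tensor_lift3_def by (intro clinear_tensor_lift biclinear_tensor_lift)

lemma tensor_lift3_pure: "triclinear f \<Longrightarrow> tensor_lift3 f (a \<otimes> b \<otimes> c) = f a b c"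
  by (simp add: tensor_lift3_def tensor_lift_pure biclinear_balanced biclinear_tensor_lift)
    (simp add: tensor_lift_pure biclinear_balanced triclinear_def)

lemma biclinear_tensor_lift3:
  assumes "\<And>a. triclinear (f a)" and "\<And>b c d. clinear (\<lambda>a. f a b c d)"
  shows "biclinear (\<lambda>a. tensor_lift3 (f a))"
proof -
  have "biclinear (f a b)" for a b
    using assms(1) by (simp add: triclinear_def)
  then have "clinear (\<lambda>a. tensor_lift (f a b) t)" for b t
    by (intro clinear_tensor_lift_param[of "\<lambda>a. f a b"] assms(2))
  then have "clinear (\<lambda>a. tensor_lift3 (f a) t)" for t
    unfolding tensor_lift3_def
    by (intro clinear_tensor_lift_param[of "\<lambda>a b. tensor_lift (f a b)"]
        biclinear_tensor_lift assms(1))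
  with assms(1) show ?thesis by (simp add: biclinear_def clinear_tensor_lift3)
qed

lemma clinear_tensor_lift4:
  assumes "\<And>a. triclinear (f a)" and "\<And>b c d. clinear (\<lambda>a. f a b c d)"
  shows "clinear (tensor_lift4 f)"
  unfolding tensor_lift4_def by (intro clinear_tensor_lift biclinear_tensor_lift3 assms)

lemma tensor_lift4_pure:
  assumes "\<And>a. triclinear (f a)" and "\<And>b c d. clinear (\<lambda>a. f a b c d)"
  shows "tensor_lift4 f (a \<otimes> b \<otimes> c \<otimes> d) = f a b c d"
  by (simp add: tensor_lift4_def tensor_lift_pure biclinear_balanced biclinear_tensor_lift3 assms)
    (simp add: tensor_lift3_pure assms)

text \<open>All identities between tensor expressions below are checked on pure tensors, where both sides
  become words in the algebra; only additivity of both sides has to be known.\<close>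

lemma additive_tensor3_eqI:
  fixes F G :: "'a::complex_vector \<otimes> 'b::complex_vector \<otimes> 'c::complex_vector \<Rightarrow> 'd::ab_group_add"
  assumes F: "\<And>s t. F (s + t) = F s + F t" and G: "\<And>s t. G (s + t) = G s + G t"
    and "\<And>a b c. F (a \<otimes> b \<otimes> c) = G (a \<otimes> b \<otimes> c)"
  shows "F t = G t"
proof (rule additive_tensor_eqI[of F G, OF F G])
  show "F (a \<otimes> t) = G (a \<otimes> t)" for a t
    by (rule additive_tensor_eqI[of "\<lambda>t. F (a \<otimes> t)" "\<lambda>t. G (a \<otimes> t)"])
      (simp_all add: F G assms(3) pure_tensor_add_right)
qed

lemma additive_tensor4_eqI:
  fixes F G :: "'a::complex_vector \<otimes> 'b::complex_vector \<otimes> 'c::complex_vector \<otimes>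
      'd::complex_vector \<Rightarrow> 'e::ab_group_add"
  assumes F: "\<And>s t. F (s + t) = F s + F t" and G: "\<And>s t. G (s + t) = G s + G t"
    and "\<And>a b c d. F (a \<otimes> b \<otimes> c \<otimes> d) = G (a \<otimes> b \<otimes> c \<otimes> d)"
  shows "F t = G t"
proof (rule additive_tensor_eqI[of F G, OF F G])
  show "F (a \<otimes> t) = G (a \<otimes> t)" for a t
    by (rule additive_tensor3_eqI[of "\<lambda>t. F (a \<otimes> t)" "\<lambda>t. G (a \<otimes> t)"])
      (simp_all add: F G assms(3) pure_tensor_add_right)
qed

lemma additive_sum_eq:
  fixes f :: "'a::ab_group_add \<Rightarrow> 'b::ab_group_add"
  assumes "\<And>x y. f (x + y) = f x + f y"
  shows "f (\<Sum>i\<in>I. g i) = (\<Sum>i\<in>I. f (g i))"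
  using additive.sum[of f g I] assms by (simp add: additive_def)

lemma mult_map_add: "mult_map (s + t) = mult_map s + mult_map t"
  unfolding mult_map_def
  by (rule tensor_lift_add) (simp add: biclinear_balanced biclinear_def)

lemma biclinear_pure_tensor: "clinear f \<Longrightarrow> clinear g \<Longrightarrow> biclinear (\<lambda>a b. f a \<otimes> g b)"
  by (auto simp: biclinear_def clinear_add clinear_scaleC pure_tensor_simps intro!: clinearI)

lemma clinear_pure_tensor [simp]: "clinear ((\<otimes>) a)" "clinear (\<lambda>a. a \<otimes> b)"
  by (auto simp: pure_tensor_simps intro!: clinearI)

lemma clinear_tensor_map [simp]: "clinear f \<Longrightarrow> clinear g \<Longrightarrow> clinear (tensor_map f g)"
  unfolding tensor_map_def by (intro clinear_tensor_lift biclinear_pure_tensor)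

lemma tensor_map_add [simp]:
  "clinear f \<Longrightarrow> clinear g \<Longrightarrow> tensor_map f g (s + t) = tensor_map f g s + tensor_map f g t"
  by (rule clinear_add) simp

declare tensor_map_pure [simp] mult_map_pure [simp] tensor_assoc_pure [simp]
  tensor_mult_pure [simp]

lemma clinear_tensor_assoc [simp]: "clinear tensor_assoc"
proof -
  have "triclinear (\<lambda>c (a::'a::complex_vector) (b::'b::complex_vector).
      a \<otimes> b \<otimes> (c::'c::complex_vector))"
    by (auto simp: triclinear_def biclinear_def pure_tensor_simps intro!: clinearI)
  from biclinear_tensor_lift[OF this] show ?thesis
    unfolding tensor_assoc_def by (intro clinear_tensor_lift) (simp add: biclinear_def)
qed

lemma tensor_assoc_add [simp]: "tensor_assoc (s + t) = tensor_assoc s + tensor_assoc t"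
  by (rule clinear_add) simp

lemma biclinear_scaleC:
  assumes "clinear f" and "clinear g"
  shows "biclinear (\<lambda>a b. f a *\<^sub>C g b)" and "biclinear (\<lambda>b a. f a *\<^sub>C g b)"
  using assms by (auto simp: biclinear_def clinear_add clinear_scaleC scaleC_add_left
      scaleC_add_right scaleC_scaleC scaleC_complex_def mult.commute intro!: clinearI)

lemma clinear_counit [simp]:
  assumes "clinear \<epsilon>"
  shows "clinear (counit_left \<epsilon>)" and "clinear (counit_right \<epsilon>)"
  using assms unfolding counit_left_def counit_right_def
  by (auto intro!: clinear_tensor_lift biclinear_scaleC biclinear_scaleC[of \<epsilon> "\<lambda>b. b"])

lemma counit_left_pure [simp]: "clinear \<epsilon> \<Longrightarrow> counit_left \<epsilon> (a \<otimes> b) = \<epsilon> a *\<^sub>C b"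
  using tensor_lift_pure[OF biclinear_balanced, OF biclinear_scaleC(1)[of \<epsilon> "\<lambda>b. b"]]
  by (simp add: counit_left_def)

lemma counit_right_pure [simp]: "clinear \<epsilon> \<Longrightarrow> counit_right \<epsilon> (a \<otimes> b) = \<epsilon> b *\<^sub>C a"
  using tensor_lift_pure[OF biclinear_balanced, OF biclinear_scaleC(2)[of \<epsilon> "\<lambda>b. b"]]
  by (simp add: counit_right_def)

lemma counit_add [simp]:
  assumes "clinear \<epsilon>"
  shows "counit_left \<epsilon> (s + t) = counit_left \<epsilon> s + counit_left \<epsilon> t"
    and "counit_right \<epsilon> (s' + t') = counit_right \<epsilon> s' + counit_right \<epsilon> t'"
  using assms by (auto intro: clinear_add)

lemma tensor_map_mult:
  assumes f: "clinear f" "\<And>x y. f (x * y) = f x * f y"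
    and g: "clinear g" "\<And>x y. g (x * y) = g x * g y"
  shows "tensor_map f g (s * t) = tensor_map f g s * tensor_map f g t"
proof (rule additive_tensor_eqI[of "\<lambda>s. tensor_map f g (s * t)"])
  show "tensor_map f g ((a \<otimes> b) * t) = tensor_map f g (a \<otimes> b) * tensor_map f g t" for a b
    by (rule additive_tensor_eqI[of "\<lambda>t. tensor_map f g ((a \<otimes> b) * t)"])
      (simp_all add: f g distrib_left)
qed (simp_all add: f g distrib_right)

lemma tensor_map_one [simp]:
  "clinear f \<Longrightarrow> clinear g \<Longrightarrow> f 1 = 1 \<Longrightarrow> g 1 = 1 \<Longrightarrow> tensor_map f g 1 = 1"
  by (simp add: one_tensor_def)

lemma tensor_assoc_one [simp]: "tensor_assoc 1 = 1"
  by (simp add: one_tensor_def)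

lemma algebra_hom_mult: "algebra_hom f \<Longrightarrow> f (x * y) = f x * f y"
  by (simp add: algebra_hom_def)

lemma algebra_hom_tensor_map:
  "algebra_hom f \<Longrightarrow> algebra_hom g \<Longrightarrow> algebra_hom (tensor_map f g)"
  by (auto simp: algebra_hom_def tensor_map_mult)

lemma algebra_hom_id [simp]: "algebra_hom id"
  by (simp add: algebra_hom_def)

lemma algebra_hom_tensor_assoc [simp]: "algebra_hom tensor_assoc"
proof -
  have pure: "tensor_assoc (((a \<otimes> b) \<otimes> c) * ((a' \<otimes> b') \<otimes> c')) =
      tensor_assoc ((a \<otimes> b) \<otimes> c) * tensor_assoc ((a' \<otimes> b') \<otimes> c')"
    for a a' :: "'a::complex_algebra_1" and b b' :: "'b::complex_algebra_1"
      and c c' :: "'c::complex_algebra_1"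
    by simp
  have 1: "tensor_assoc (((a \<otimes> b) \<otimes> c) * (s \<otimes> c')) =
      tensor_assoc ((a \<otimes> b) \<otimes> c) * tensor_assoc (s \<otimes> c')"
    for a :: 'a and b :: 'b and c c' :: 'c and s
    by (rule additive_tensor_eqI[of "\<lambda>s. tensor_assoc (((a \<otimes> b) \<otimes> c) * (s \<otimes> c'))"])
      (simp_all add: pure_tensor_add_left distrib_left)
  have 2: "tensor_assoc (((a \<otimes> b) \<otimes> c) * t) = tensor_assoc ((a \<otimes> b) \<otimes> c) * tensor_assoc t"
    for a :: 'a and b :: 'b and c :: 'c and t
    by (rule additive_tensor_eqI[of "\<lambda>t. tensor_assoc (((a \<otimes> b) \<otimes> c) * t)"])
      (simp_all only: 1 distrib_left tensor_assoc_add)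
  have 3: "tensor_assoc ((s \<otimes> c) * t) = tensor_assoc (s \<otimes> c) * tensor_assoc t"
    for s :: "'a \<otimes> 'b" and c :: 'c and t
    by (rule additive_tensor_eqI[of "\<lambda>s. tensor_assoc ((s \<otimes> c) * t)"])
      (simp_all only: 2 distrib_right tensor_assoc_add pure_tensor_add_left)
  have "tensor_assoc (s * t) = tensor_assoc s * tensor_assoc t"
    for s t :: "('a \<otimes> 'b) \<otimes> 'c"
    by (rule additive_tensor_eqI[of "\<lambda>s. tensor_assoc (s * t)"])
      (simp_all only: 3 distrib_right tensor_assoc_add)
  then show ?thesis by (simp add: algebra_hom_def)
qed

lemma tensor_assoc_mult: "tensor_assoc (s * t) = tensor_assoc s * tensor_assoc t"
  by (rule algebra_hom_mult[OF algebra_hom_tensor_assoc])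

lemma algebra_hom_counit:
  assumes "algebra_hom (\<epsilon> :: 'a::complex_algebra_1 \<Rightarrow> complex)"
  shows "algebra_hom (counit_left \<epsilon> :: 'a \<otimes> 'b::complex_algebra_1 \<Rightarrow> 'b)"
    and "algebra_hom (counit_right \<epsilon> :: 'b \<otimes> 'a \<Rightarrow> 'b)"
proof -
  have lin [simp]: "clinear \<epsilon>" and eps [simp]: "\<epsilon> 1 = 1" "\<And>x y. \<epsilon> (x * y) = \<epsilon> x * \<epsilon> y"
    using assms by (simp_all add: algebra_hom_def)
  have l: "counit_left \<epsilon> ((a \<otimes> b) * t) = counit_left \<epsilon> (a \<otimes> b) * counit_left \<epsilon> t"
    for a and b :: 'b and t
    by (rule additive_tensor_eqI[of "\<lambda>t. counit_left \<epsilon> ((a \<otimes> b) * t)"])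
      (simp_all add: distrib_left mult_scaleC_left mult_scaleC_right scaleC_scaleC mult.commute)
  have r: "counit_right \<epsilon> ((b \<otimes> a) * t) = counit_right \<epsilon> (b \<otimes> a) * counit_right \<epsilon> t"
    for a and b :: 'b and t
    by (rule additive_tensor_eqI[of "\<lambda>t. counit_right \<epsilon> ((b \<otimes> a) * t)"])
      (simp_all add: distrib_left mult_scaleC_left mult_scaleC_right scaleC_scaleC mult.commute)
  have "counit_left \<epsilon> (s * t) = counit_left \<epsilon> s * counit_left \<epsilon> t" for s t :: "'a \<otimes> 'b"
    by (rule additive_tensor_eqI[of "\<lambda>s. counit_left \<epsilon> (s * t)"])
      (simp_all only: l distrib_right counit_add lin)
  moreover have "counit_right \<epsilon> (s * t) = counit_right \<epsilon> s * counit_right \<epsilon> t"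
    for s t :: "'b \<otimes> 'a"
    by (rule additive_tensor_eqI[of "\<lambda>s. counit_right \<epsilon> (s * t)"])
      (simp_all only: r distrib_right counit_add lin)
  ultimately show "algebra_hom (counit_left \<epsilon> :: 'a \<otimes> 'b \<Rightarrow> 'b)"
    "algebra_hom (counit_right \<epsilon> :: 'b \<otimes> 'a \<Rightarrow> 'b)"
    by (simp_all add: algebra_hom_def) (simp_all add: one_tensor_def scaleC_one)
qed

section \<open>Evaluating tensors with an antipode\<close>

text \<open>The element \<open>\<alpha>\<close> plays the role of an evaluation and \<open>\<beta>\<close> that of a coevaluation for the duality
  given by \<open>S\<close>; \<open>snake\<close> and \<open>cosnake\<close> are the two composites that occur in the triangle identities
  of that duality. Allowing different antipodes at the two ends of \<open>snake\<close> is what produces the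
  element that compares them. The functionals in four arguments merge a snake of mixed type
  with a further evaluation or coevaluation; they are applied to the pentagon.\<close>

definition eval_pair ::
  "('a \<Rightarrow> 'a) \<Rightarrow> 'a \<Rightarrow> 'a \<otimes> 'a \<Rightarrow> 'a::complex_algebra_1" where
  "eval_pair S \<alpha> = tensor_lift (\<lambda>x y. S x * \<alpha> * y)"

definition coeval_pair ::
  "'a \<Rightarrow> ('a \<Rightarrow> 'a) \<Rightarrow> 'a \<otimes> 'a \<Rightarrow> 'a::complex_algebra_1" where
  "coeval_pair \<beta> S = tensor_lift (\<lambda>x y. x * \<beta> * S y)"

definition snake ::
  "('a \<Rightarrow> 'a) \<Rightarrow> 'a \<Rightarrow> 'a \<Rightarrow> ('a \<Rightarrow> 'a) \<Rightarrow> 'a \<otimes> 'a \<otimes> 'a \<Rightarrow> 'a::complex_algebra_1" where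
  "snake S \<alpha> \<beta> T = tensor_lift3 (\<lambda>x y z. S x * \<alpha> * y * \<beta> * T z)"

definition cosnake ::
  "'a \<Rightarrow> ('a \<Rightarrow> 'a) \<Rightarrow> 'a \<Rightarrow> 'a \<otimes> 'a \<otimes> 'a \<Rightarrow> 'a::complex_algebra_1" where
  "cosnake \<beta> S \<alpha> = tensor_lift3 (\<lambda>x y z. x * \<beta> * S y * \<alpha> * z)"

definition snake4 :: "('a \<Rightarrow> 'a) \<Rightarrow> 'a \<Rightarrow> 'a \<Rightarrow> ('a \<Rightarrow> 'a) \<Rightarrow> 'a \<Rightarrow>
    'a \<otimes> 'a \<otimes> 'a \<otimes> 'a \<Rightarrow> 'a::complex_algebra_1" where
  "snake4 S \<alpha> \<delta> T \<gamma> = tensor_lift4 (\<lambda>a b c d. S a * \<alpha> * b * \<delta> * T c * \<gamma> * d)"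

definition cosnake4 :: "'a \<Rightarrow> ('a \<Rightarrow> 'a) \<Rightarrow> 'a \<Rightarrow> 'a \<Rightarrow> ('a \<Rightarrow> 'a) \<Rightarrow>
    'a \<otimes> 'a \<otimes> 'a \<otimes> 'a \<Rightarrow> 'a::complex_algebra_1" where
  "cosnake4 \<beta> S \<alpha> \<delta> T = tensor_lift4 (\<lambda>a b c d. a * \<beta> * S b * \<alpha> * c * \<delta> * T d)"

lemma eval_pair_simps [simp]:
  assumes "clinear S"
  shows "eval_pair S \<alpha> (x \<otimes> y) = S x * \<alpha> * y"
    and "eval_pair S \<alpha> (s + t) = eval_pair S \<alpha> s + eval_pair S \<alpha> t"
    and "eval_pair S \<alpha> (c *\<^sub>C t) = c *\<^sub>C eval_pair S \<alpha> t"
    and "coeval_pair \<beta> S (x \<otimes> y) = x * \<beta> * S y"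
    and "coeval_pair \<beta> S (s + t) = coeval_pair \<beta> S s + coeval_pair \<beta> S t"
    and "coeval_pair \<beta> S (c *\<^sub>C t) = c *\<^sub>C coeval_pair \<beta> S t"
proof -
  have "biclinear (\<lambda>x y. S x * \<alpha> * y)" "biclinear (\<lambda>x y. x * \<beta> * S y)"
    using assms by (simp_all add: biclinear_def)
  note lin = this
  note bal = lin[THEN biclinear_balanced]
  show "eval_pair S \<alpha> (x \<otimes> y) = S x * \<alpha> * y"
    "eval_pair S \<alpha> (s + t) = eval_pair S \<alpha> s + eval_pair S \<alpha> t"
    "eval_pair S \<alpha> (c *\<^sub>C t) = c *\<^sub>C eval_pair S \<alpha> t"
    "coeval_pair \<beta> S (x \<otimes> y) = x * \<beta> * S y"
    "coeval_pair \<beta> S (s + t) = coeval_pair \<beta> S s + coeval_pair \<beta> S t"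
    "coeval_pair \<beta> S (c *\<^sub>C t) = c *\<^sub>C coeval_pair \<beta> S t"
    unfolding eval_pair_def coeval_pair_def
    by (simp_all add: tensor_lift_pure[OF bal(1)] tensor_lift_pure[OF bal(2)]
        tensor_lift_add[OF bal(1)] tensor_lift_add[OF bal(2)]
        clinear_scaleC[OF clinear_tensor_lift[OF lin(1)]]
        clinear_scaleC[OF clinear_tensor_lift[OF lin(2)]])
qed

lemma snake_simps [simp]:
  assumes "clinear S" and "clinear T"
  shows "snake S \<alpha> \<beta> T (x \<otimes> y \<otimes> z) = S x * \<alpha> * y * \<beta> * T z"
    and "snake S \<alpha> \<beta> T (s + t) = snake S \<alpha> \<beta> T s + snake S \<alpha> \<beta> T t"
proof -
  have tri: "triclinear (\<lambda>x y z. S x * \<alpha> * y * \<beta> * T z)"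
    using assms by (simp add: triclinear_def biclinear_def)
  show "snake S \<alpha> \<beta> T (x \<otimes> y \<otimes> z) = S x * \<alpha> * y * \<beta> * T z"
    unfolding snake_def by (rule tensor_lift3_pure[OF tri])
  show "snake S \<alpha> \<beta> T (s + t) = snake S \<alpha> \<beta> T s + snake S \<alpha> \<beta> T t"
    unfolding snake_def by (rule clinear_add[OF clinear_tensor_lift3[OF tri]])
qed

lemma cosnake_simps [simp]:
  assumes "clinear S"
  shows "cosnake \<beta> S \<alpha> (x \<otimes> y \<otimes> z) = x * \<beta> * S y * \<alpha> * z"
    and "cosnake \<beta> S \<alpha> (s + t) = cosnake \<beta> S \<alpha> s + cosnake \<beta> S \<alpha> t"
proof -
  have tri: "triclinear (\<lambda>x y z. x * \<beta> * S y * \<alpha> * z)"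
    using assms by (simp add: triclinear_def biclinear_def)
  show "cosnake \<beta> S \<alpha> (x \<otimes> y \<otimes> z) = x * \<beta> * S y * \<alpha> * z"
    unfolding cosnake_def by (rule tensor_lift3_pure[OF tri])
  show "cosnake \<beta> S \<alpha> (s + t) = cosnake \<beta> S \<alpha> s + cosnake \<beta> S \<alpha> t"
    unfolding cosnake_def by (rule clinear_add[OF clinear_tensor_lift3[OF tri]])
qed

lemma snake4_simps [simp]:
  assumes "clinear S" and "clinear T"
  shows "snake4 S \<alpha> \<delta> T \<gamma> (a \<otimes> b \<otimes> c \<otimes> d) = S a * \<alpha> * b * \<delta> * T c * \<gamma> * d"
    and "snake4 S \<alpha> \<delta> T \<gamma> (s + t) = snake4 S \<alpha> \<delta> T \<gamma> s + snake4 S \<alpha> \<delta> T \<gamma> t"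
    and "cosnake4 \<beta> S \<alpha> \<delta> T (a \<otimes> b \<otimes> c \<otimes> d) = a * \<beta> * S b * \<alpha> * c * \<delta> * T d"
    and "cosnake4 \<beta> S \<alpha> \<delta> T (s + t) = cosnake4 \<beta> S \<alpha> \<delta> T s + cosnake4 \<beta> S \<alpha> \<delta> T t"
proof -
  have tri: "triclinear (\<lambda>b c d. S a * \<alpha> * b * \<delta> * T c * \<gamma> * d)"
    "clinear (\<lambda>a. S a * \<alpha> * b * \<delta> * T c * \<gamma> * d)"
    "triclinear (\<lambda>b c d. a * \<beta> * S b * \<alpha> * c * \<delta> * T d)"
    "clinear (\<lambda>a. a * \<beta> * S b * \<alpha> * c * \<delta> * T d)" for a b c d
    using assms by (simp_all add: triclinear_def biclinear_def)
  show "snake4 S \<alpha> \<delta> T \<gamma> (a \<otimes> b \<otimes> c \<otimes> d) = S a * \<alpha> * b * \<delta> * T c * \<gamma> * d"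
    "cosnake4 \<beta> S \<alpha> \<delta> T (a \<otimes> b \<otimes> c \<otimes> d) = a * \<beta> * S b * \<alpha> * c * \<delta> * T d"
    unfolding snake4_def cosnake4_def by (rule tensor_lift4_pure, (rule tri)+)+
  show "snake4 S \<alpha> \<delta> T \<gamma> (s + t) = snake4 S \<alpha> \<delta> T \<gamma> s + snake4 S \<alpha> \<delta> T \<gamma> t"
    "cosnake4 \<beta> S \<alpha> \<delta> T (s + t) = cosnake4 \<beta> S \<alpha> \<delta> T s + cosnake4 \<beta> S \<alpha> \<delta> T t"
    unfolding snake4_def cosnake4_def
    by (rule clinear_add, rule clinear_tensor_lift4, (rule tri)+)+
qed

section \<open>Quasi-bialgebras and quasi-antipodes\<close>

locale augmented_comultiplication =
  fixes \<epsilon> :: "'a::complex_algebra_1 \<Rightarrow> complex" and \<Delta> :: "'a \<Rightarrow> 'a \<otimes> 'a"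
  assumes counit_hom: "algebra_hom \<epsilon>" and comult_hom: "algebra_hom \<Delta>"
begin

lemma hom_simps [simp]:
  "clinear \<epsilon>" "clinear \<Delta>" "\<epsilon> 1 = 1" "\<Delta> 1 = 1"
  "\<epsilon> (x * y) = \<epsilon> x * \<epsilon> y" "\<epsilon> (x + y) = \<epsilon> x + \<epsilon> y" "\<epsilon> (c *\<^sub>C x) = c * \<epsilon> x"
  "\<Delta> (x * y) = \<Delta> x * \<Delta> y" "\<Delta> (x + y) = \<Delta> x + \<Delta> y"
  using counit_hom comult_hom
  by (auto simp: algebra_hom_def clinear_add clinear_scaleC scaleC_complex_def)

lemma counit_mult [simp]:
  "counit_left \<epsilon> (s * t) = counit_left \<epsilon> s * counit_left \<epsilon> t"
  "counit_right \<epsilon> (s' * t') = counit_right \<epsilon> s' * counit_right \<epsilon> t'"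
  and counit_one [simp]: "counit_left \<epsilon> 1 = 1" "counit_right \<epsilon> 1 = 1"
  using algebra_hom_counit[OF counit_hom] by (auto simp: algebra_hom_def)

end

text \<open>The inverse \<open>\<Psi>\<close> of the co-associator is a parameter, since conjugation exchanges the two roles.\<close>

locale quasi_bialgebra = augmented_comultiplication \<epsilon> \<Delta>
  for \<epsilon> :: "'a::complex_algebra_1 \<Rightarrow> complex" and \<Delta> :: "'a \<Rightarrow> 'a \<otimes> 'a" +
  fixes \<Phi> \<Psi> :: "'a \<otimes> 'a \<otimes> 'a"
  assumes assoc_inverse: "\<Phi> * \<Psi> = 1" "\<Psi> * \<Phi> = 1"
    and counit_comult: "counit_left \<epsilon> (\<Delta> a) = a" "counit_right \<epsilon> (\<Delta> a) = a"
    and quasi_coassoc: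
      "\<Phi> * tensor_map id \<Delta> (\<Delta> a) = tensor_assoc (tensor_map \<Delta> id (\<Delta> a)) * \<Phi>"
    and pentagon:
      "tensor_assoc (tensor_map \<Delta> id \<Phi>) * tensor_map id (tensor_map id \<Delta>) \<Phi> =
       tensor_map id tensor_assoc (tensor_assoc (\<Phi> \<otimes> 1)) *
       tensor_map id tensor_assoc (tensor_map id (tensor_map \<Delta> id) \<Phi>) *
       (1 \<otimes> \<Phi>)"
    and counit_middle: "tensor_map id (counit_left \<epsilon>) \<Phi> = 1"

text \<open>Kept apart from the quasi-bialgebra axioms because two such structures on one quasi-bialgebra are
  to be compared.\<close>

locale quasi_antipode = augmented_comultiplication \<epsilon> \<Delta>
  for \<epsilon> :: "'a::complex_algebra_1 \<Rightarrow> complex" and \<Delta> :: "'a \<Rightarrow> 'a \<otimes> 'a" +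
  fixes \<Phi> \<Psi> :: "'a \<otimes> 'a \<otimes> 'a" and S :: "'a \<Rightarrow> 'a" and \<alpha> \<beta> :: 'a
  assumes antihom: "algebra_antihom S"
    and snake: "snake S \<alpha> \<beta> S \<Phi> = 1"
    and cosnake: "cosnake \<beta> S \<alpha> \<Psi> = 1"
    and eval_comult: "eval_pair S \<alpha> (\<Delta> a) = \<epsilon> a *\<^sub>C \<alpha>"
    and coeval_comult: "coeval_pair \<beta> S (\<Delta> a) = \<epsilon> a *\<^sub>C \<beta>"
begin

lemma antipode_simps [simp]:
  "clinear S" "S 1 = 1" "S (x * y) = S y * S x" "S (x + y) = S x + S y"
  "S (c *\<^sub>C x) = c *\<^sub>C S x"
  using antihom by (auto simp: algebra_antihom_def clinear_add clinear_scaleC)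

lemma eval_pair_mult_pure: "eval_pair S \<alpha> (s * (x \<otimes> y)) = S x * eval_pair S \<alpha> s * y"
  by (rule additive_tensor_eqI[of "\<lambda>s. eval_pair S \<alpha> (s * (x \<otimes> y))"])
    (simp_all add: distrib_left distrib_right mult.assoc)

lemma coeval_pair_pure_mult: "coeval_pair \<beta> S ((x \<otimes> y) * s) = x * coeval_pair \<beta> S s * S y"
  by (rule additive_tensor_eqI[of "\<lambda>s. coeval_pair \<beta> S ((x \<otimes> y) * s)"])
    (simp_all add: distrib_left distrib_right mult.assoc)

text \<open>A comultiplied leg placed around \<open>\<alpha>\<close> or \<open>\<beta>\<close> is absorbed by it and leaves only a counit. In the
  product with \<open>1 \<otimes> \<Delta>\<close> the two new factors meet at \<open>\<alpha>\<close>, in the product with \<open>\<Delta> \<otimes> 1\<close> at \<open>\<beta>\<close>.\<close>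

lemma cosnake_comult_left:
  "cosnake \<beta> S \<alpha> (tensor_map id \<Delta> t * u) = counit_right \<epsilon> t * cosnake \<beta> S \<alpha> u"
proof (rule additive_tensor_eqI[of "\<lambda>t. cosnake \<beta> S \<alpha> (tensor_map id \<Delta> t * u)"])
  fix a b
  have "cosnake \<beta> S \<alpha> ((a \<otimes> s) * (x \<otimes> y \<otimes> z)) = a * x * \<beta> * S y * eval_pair S \<alpha> s * z"
    for s x y z
    by (rule additive_tensor_eqI[of "\<lambda>s. cosnake \<beta> S \<alpha> ((a \<otimes> s) * (x \<otimes> y \<otimes> z))"])
      (simp_all add: pure_tensor_simps distrib_left distrib_right mult.assoc)
  note pure = this[of "\<Delta> b"]
  show "cosnake \<beta> S \<alpha> (tensor_map id \<Delta> (a \<otimes> b) * u) =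
      counit_right \<epsilon> (a \<otimes> b) * cosnake \<beta> S \<alpha> u"
    by (rule additive_tensor3_eqI[of "\<lambda>u. cosnake \<beta> S \<alpha> (tensor_map id \<Delta> (a \<otimes> b) * u)"])
      (simp_all add: distrib_left eval_comult mult_scaleC_left mult_scaleC_right scaleC_add_right mult.assoc
        pure[simplified mult.assoc] del: tensor_mult_pure)
qed (simp_all add: distrib_right)

lemma cosnake_comult_right:
  "cosnake \<beta> S \<alpha> (u * tensor_assoc (tensor_map \<Delta> id t)) =
    cosnake \<beta> S \<alpha> u * counit_left \<epsilon> t"
proof (rule additive_tensor_eqI[of
      "\<lambda>t. cosnake \<beta> S \<alpha> (u * tensor_assoc (tensor_map \<Delta> id t))"])
  fix a b
  have "cosnake \<beta> S \<alpha> ((x \<otimes> y \<otimes> z) * tensor_assoc (s \<otimes> b)) =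
      x * coeval_pair \<beta> S s * S y * \<alpha> * z * b" for s x y z
    by (rule additive_tensor_eqI[of
          "\<lambda>s. cosnake \<beta> S \<alpha> ((x \<otimes> y \<otimes> z) * tensor_assoc (s \<otimes> b))"])
      (simp_all add: pure_tensor_simps distrib_left distrib_right mult.assoc)
  note pure = this[of _ _ _ "\<Delta> a"]
  show "cosnake \<beta> S \<alpha> (u * tensor_assoc (tensor_map \<Delta> id (a \<otimes> b))) =
      cosnake \<beta> S \<alpha> u * counit_left \<epsilon> (a \<otimes> b)"
    by (rule additive_tensor3_eqI[of
          "\<lambda>u. cosnake \<beta> S \<alpha> (u * tensor_assoc (tensor_map \<Delta> id (a \<otimes> b)))"])
      (simp_all add: distrib_right coeval_comult mult_scaleC_left mult_scaleC_right scaleC_add_right mult.assoc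
        pure[simplified mult.assoc] del: tensor_mult_pure)
qed (simp_all add: distrib_left)

end

locale two_quasi_antipodes =
  A: quasi_antipode \<epsilon> \<Delta> \<Phi> \<Psi> S \<alpha> \<beta> + B: quasi_antipode \<epsilon> \<Delta> \<Phi> \<Psi> T \<gamma> \<delta>
  for \<epsilon> :: "'a::complex_algebra_1 \<Rightarrow> complex" and \<Delta> \<Phi> \<Psi> S \<alpha> \<beta> T \<gamma> \<delta>
begin

text \<open>The same absorption for \<open>snake\<close>, with the roles exchanged: \<open>\<Delta> \<otimes> 1\<close> meets \<open>\<alpha>\<close> and \<open>1 \<otimes> \<Delta>\<close> meets
  the coevaluation \<open>\<delta>\<close> of the second antipode. The uncontracted leg comes out at the far end,
  under that end's antipode.\<close>

lemma snake_comult_left: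
  "snake S \<alpha> \<delta> T (tensor_assoc (tensor_map \<Delta> id t) * u) =
    snake S \<alpha> \<delta> T u * T (counit_left \<epsilon> t)"
proof (rule additive_tensor_eqI[of
      "\<lambda>t. snake S \<alpha> \<delta> T (tensor_assoc (tensor_map \<Delta> id t) * u)"])
  fix a b
  have "snake S \<alpha> \<delta> T (tensor_assoc (s \<otimes> b) * (x \<otimes> y \<otimes> z)) =
      S x * eval_pair S \<alpha> s * y * \<delta> * T z * T b" for s x y z
    by (rule additive_tensor_eqI[of
          "\<lambda>s. snake S \<alpha> \<delta> T (tensor_assoc (s \<otimes> b) * (x \<otimes> y \<otimes> z))"])
      (simp_all add: pure_tensor_simps distrib_left distrib_right mult.assoc)
  note pure = this[of "\<Delta> a"]
  show "snake S \<alpha> \<delta> T (tensor_assoc (tensor_map \<Delta> id (a \<otimes> b)) * u) =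
      snake S \<alpha> \<delta> T u * T (counit_left \<epsilon> (a \<otimes> b))"
    by (rule additive_tensor3_eqI[of
          "\<lambda>u. snake S \<alpha> \<delta> T (tensor_assoc (tensor_map \<Delta> id (a \<otimes> b)) * u)"])
      (simp_all add: distrib_left distrib_right A.eval_comult scaleC_add_right mult_scaleC_left mult_scaleC_right
        mult.assoc pure[simplified mult.assoc] del: tensor_mult_pure)
qed (simp_all add: distrib_left distrib_right)

lemma snake_comult_right:
  "snake S \<alpha> \<delta> T (u * tensor_map id \<Delta> t) = S (counit_right \<epsilon> t) * snake S \<alpha> \<delta> T u"
proof (rule additive_tensor_eqI[of "\<lambda>t. snake S \<alpha> \<delta> T (u * tensor_map id \<Delta> t)"])
  fix a b
  have "snake S \<alpha> \<delta> T ((x \<otimes> y \<otimes> z) * (a \<otimes> s)) = S a * S x * \<alpha> * y * coeval_pair \<delta> T s * T z"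
    for s x y z
    by (rule additive_tensor_eqI[of "\<lambda>s. snake S \<alpha> \<delta> T ((x \<otimes> y \<otimes> z) * (a \<otimes> s))"])
      (simp_all add: pure_tensor_simps distrib_left distrib_right mult.assoc)
  note pure = this[of _ _ _ "\<Delta> b"]
  show "snake S \<alpha> \<delta> T (u * tensor_map id \<Delta> (a \<otimes> b)) =
      S (counit_right \<epsilon> (a \<otimes> b)) * snake S \<alpha> \<delta> T u"
    by (rule additive_tensor3_eqI[of "\<lambda>u. snake S \<alpha> \<delta> T (u * tensor_map id \<Delta> (a \<otimes> b))"])
      (simp_all add: distrib_left distrib_right B.coeval_comult scaleC_add_right mult_scaleC_left
        mult_scaleC_right mult.assoc pure[simplified mult.assoc] del: tensor_mult_pure)
qed (simp_all add: distrib_left distrib_right)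

end

context quasi_bialgebra
begin

text \<open>Normalization of \<open>\<Phi>\<close> in the middle leg forces it in the outer legs. Here the counit is applied to
  the second leg of the pentagon: two of its factors collapse to 1 by the middle normalization,
  two become \<open>\<Phi>\<close>, and cancelling \<open>\<Phi>\<close> leaves the claim.\<close>

lemma counit_left_coassociator: "counit_left \<epsilon> \<Phi> = 1"
proof -
  let ?E = "tensor_map id (counit_left \<epsilon>) :: 'a \<otimes> 'a \<otimes> 'a \<otimes> 'a \<Rightarrow> 'a \<otimes> 'a \<otimes> 'a"
  have E_mult: "?E (s * t) = ?E s * ?E t" for s t
    by (rule tensor_map_mult) simp_all
  have comult1: "?E (tensor_assoc (s \<otimes> t)) = counit_right \<epsilon> s \<otimes> t" for s t
    by (rule additive_tensor_eqI[of "\<lambda>s. ?E (tensor_assoc (s \<otimes> t))"])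
      (simp_all add: pure_tensor_simps)
  have E1: "?E (tensor_assoc (tensor_map \<Delta> id t)) = t" for t
    by (rule additive_tensor_eqI[of "\<lambda>t. ?E (tensor_assoc (tensor_map \<Delta> id t))"])
      (simp_all add: comult1 counit_comult)
  have E2: "?E (tensor_map id (tensor_map id \<Delta>) t) =
      tensor_map id \<Delta> (tensor_map id (counit_left \<epsilon>) t)" for t
    by (rule additive_tensor3_eqI[of "\<lambda>t. ?E (tensor_map id (tensor_map id \<Delta>) t)"])
      (simp_all add: clinear_scaleC)
  have E3: "?E (tensor_map id tensor_assoc (tensor_assoc (t \<otimes> 1))) =
      tensor_assoc (tensor_map id (counit_left \<epsilon>) t \<otimes> 1)" for t
    by (rule additive_tensor3_eqI[of
          "\<lambda>t. ?E (tensor_map id tensor_assoc (tensor_assoc (t \<otimes> 1)))"])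
      (simp_all add: pure_tensor_simps clinear_scaleC)
  have comult2: "counit_left \<epsilon> (tensor_assoc (s \<otimes> t)) = counit_left \<epsilon> s \<otimes> t"
    for s :: "'a \<otimes> 'a" and t :: 'a
    by (rule additive_tensor_eqI[of "\<lambda>s. counit_left \<epsilon> (tensor_assoc (s \<otimes> t))"])
      (simp_all add: pure_tensor_simps)
  have E4: "?E (tensor_map id tensor_assoc (tensor_map id (tensor_map \<Delta> id) t)) = t" for t
    by (rule additive_tensor3_eqI[of
          "\<lambda>t. ?E (tensor_map id tensor_assoc (tensor_map id (tensor_map \<Delta> id) t))"])
      (simp_all add: comult2 counit_comult)
  have "\<Phi> * tensor_map id \<Delta> 1 = tensor_assoc (1 \<otimes> 1) * \<Phi> * (1 \<otimes> counit_left \<epsilon> \<Phi>)"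
    using arg_cong[OF pentagon, of ?E]
    by (simp only: E_mult E1 E2 E3 E4 counit_middle) simp
  then have "\<Phi> = \<Phi> * (1 \<otimes> counit_left \<epsilon> \<Phi>)"
    by (simp add: one_tensor_def[symmetric])
  then have "\<Psi> * \<Phi> = \<Psi> * \<Phi> * (1 \<otimes> counit_left \<epsilon> \<Phi>)"
    by (metis mult.assoc)
  then have "1 \<otimes> (counit_left \<epsilon> \<Phi>) = (1 :: 'a \<otimes> 'a \<otimes> 'a)"
    by (simp add: assoc_inverse)
  then have "counit_left \<epsilon> ((1::'a) \<otimes> (counit_left \<epsilon> \<Phi>)) = 1"
    by (simp only: counit_one)
  then show ?thesis by (simp add: scaleC_one)
qed

text \<open>The same argument with the counit in the third leg of the pentagon.\<close>

lemma counit_right_coassociator: "tensor_map id (counit_right \<epsilon>) \<Phi> = 1"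
proof -
  let ?E = "tensor_map id (tensor_map id (counit_left \<epsilon>)) ::
    'a \<otimes> 'a \<otimes> 'a \<otimes> 'a \<Rightarrow> 'a \<otimes> 'a \<otimes> 'a"
  let ?u = "tensor_map id (counit_right \<epsilon>) \<Phi>"
  let ?i = "tensor_map id (\<lambda>y. y \<otimes> 1) :: 'a \<otimes> 'a \<Rightarrow> 'a \<otimes> 'a \<otimes> 'a"
  have E_mult: "?E (s * t) = ?E s * ?E t" for s t
    by (intro tensor_map_mult) simp_all
  have comult1: "?E (tensor_assoc (s \<otimes> t)) =
      tensor_assoc (s \<otimes> counit_left \<epsilon> t)" for s :: "'a \<otimes> 'a" and t
    by (rule additive_tensor_eqI[of "\<lambda>s. ?E (tensor_assoc (s \<otimes> t))"])
      (simp_all add: pure_tensor_add_left pure_tensor_add_right)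
  have E1: "?E (tensor_assoc (tensor_map \<Delta> id t)) =
      tensor_assoc (tensor_map \<Delta> id (tensor_map id (counit_left \<epsilon>) t))" for t
    by (rule additive_tensor_eqI[of "\<lambda>t. ?E (tensor_assoc (tensor_map \<Delta> id t))"])
      (simp_all add: comult1)
  have E2: "?E (tensor_map id (tensor_map id \<Delta>) t) = t" for t
    by (rule additive_tensor3_eqI[of "\<lambda>t. ?E (tensor_map id (tensor_map id \<Delta>) t)"])
      (simp_all add: counit_comult)
  have E3: "?E (tensor_map id tensor_assoc (tensor_assoc (t \<otimes> 1))) =
      ?i (tensor_map id (counit_right \<epsilon>) t)" for t
    by (rule additive_tensor3_eqI[of
          "\<lambda>t. ?E (tensor_map id tensor_assoc (tensor_assoc (t \<otimes> 1)))"])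
      (simp_all add: pure_tensor_simps clinear_scaleC)
  have comult2: "tensor_map id (counit_left \<epsilon>) (tensor_assoc (s \<otimes> t)) = counit_right \<epsilon> s \<otimes> t"
    for s :: "'a \<otimes> 'a" and t :: 'a
    by (rule additive_tensor_eqI[of
          "\<lambda>s. tensor_map id (counit_left \<epsilon>) (tensor_assoc (s \<otimes> t))"])
      (simp_all add: pure_tensor_simps)
  have E4: "?E (tensor_map id tensor_assoc (tensor_map id (tensor_map \<Delta> id) t)) = t" for t
    by (rule additive_tensor3_eqI[of
          "\<lambda>t. ?E (tensor_map id tensor_assoc (tensor_map id (tensor_map \<Delta> id) t))"])
      (simp_all add: comult2 counit_comult)
  have "tensor_assoc (tensor_map \<Delta> id 1) * \<Phi> = ?i ?u * \<Phi> * (1 \<otimes> 1)"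
    using arg_cong[OF pentagon, of ?E]
    by (simp only: E_mult E1 E2 E3 E4 counit_middle) (simp add: counit_middle)
  then have "\<Phi> = ?i ?u * \<Phi>"
    by (simp add: one_tensor_def[symmetric])
  then have "\<Phi> * \<Psi> = ?i ?u * (\<Phi> * \<Psi>)"
    by (metis mult.assoc)
  then have "?i ?u = 1"
    by (simp add: assoc_inverse)
  moreover have "tensor_map id (counit_right \<epsilon>) (?i t) = t" for t
    by (rule additive_tensor_eqI[of "\<lambda>t. tensor_map id (counit_right \<epsilon>) (?i t)"])
      (simp_all add: scaleC_one)
  ultimately have "?u = tensor_map id (counit_right \<epsilon>) 1"
    by metis
  then show ?thesis by (simp add: one_tensor_def scaleC_one)
qed

end

section \<open>Uniqueness of the quasi-antipode\<close>

locale quasi_bialgebra_two_antipodes =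
  quasi_bialgebra \<epsilon> \<Delta> \<Phi> \<Psi> + two_quasi_antipodes \<epsilon> \<Delta> \<Phi> \<Psi> S \<alpha> \<beta> T \<gamma> \<delta>
  for \<epsilon> :: "'a::complex_algebra_1 \<Rightarrow> complex" and \<Delta> \<Phi> \<Psi> S \<alpha> \<beta> T \<gamma> \<delta>
begin

text \<open>Both sides are \<open>snake\<close> of the two sides of quasi-coassociativity at \<open>a\<close>: on either side the
  comultiplied leg is absorbed and \<open>a\<close> itself comes out at one end.\<close>

lemma snake_intertwines: "S a * snake S \<alpha> \<delta> T \<Phi> = snake S \<alpha> \<delta> T \<Phi> * T a"
  using snake_comult_left[of "\<Delta> a" \<Phi>] snake_comult_right[of \<Phi> "\<Delta> a"]
  by (simp add: quasi_coassoc counit_comult)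

text \<open>The functional \<open>S a \<alpha> b \<delta> T c \<gamma> d\<close> is applied to the pentagon multiplied from the right by
  \<open>1 \<otimes> \<Psi>\<close>. This factor is moved to the side where it completes the \<open>cosnake\<close> of the second
  antipode: there every other factor is absorbed into counits of \<open>\<Phi>\<close>, which leaves \<open>\<alpha>\<close>. On the other
  side \<open>1 \<otimes> \<Delta> \<otimes> 1\<close> is absorbed at \<open>\<delta>\<close> and only the snake followed by \<open>\<gamma>\<close> remains.\<close>

lemma snake_eval: "snake S \<alpha> \<delta> T \<Phi> * \<gamma> = \<alpha>"
proof -
  let ?L = "snake4 S \<alpha> \<delta> T \<gamma>"
  have L: "?L (x \<otimes> y \<otimes> w) = S x * \<alpha> * y * \<delta> * eval_pair T \<gamma> w" for x y w
    by (rule additive_tensor_eqI[of "\<lambda>w. ?L (x \<otimes> y \<otimes> w)"])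
      (simp_all add: pure_tensor_add_right distrib_left mult.assoc)
  have L_left: "?L (tensor_assoc (s \<otimes> t) * (x \<otimes> y \<otimes> v)) =
      S x * eval_pair S \<alpha> s * y * \<delta> * eval_pair T \<gamma> (t * v)" for s t x y v
    by (rule additive_tensor_eqI[of "\<lambda>s. ?L (tensor_assoc (s \<otimes> t) * (x \<otimes> y \<otimes> v))"])
      (simp_all add: L pure_tensor_add_left distrib_left distrib_right mult.assoc)
  \<comment> \<open>The factor \<open>(\<Delta> \<otimes> 1 \<otimes> 1) \<Phi>\<close> meets \<open>\<alpha>\<close>, the factor \<open>(1 \<otimes> 1 \<otimes> \<Delta>) \<Phi>\<close> then meets \<open>\<gamma>\<close>.\<close>
  have outer: "?L (tensor_assoc (tensor_map \<Delta> id (a \<otimes> t)) * u) =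
      ?L ((1 \<otimes> 1 \<otimes> counit_left \<epsilon> (a \<otimes> t)) * u)" for a t u
    by (rule additive_tensor3_eqI[of
          "\<lambda>u. ?L (tensor_assoc (tensor_map \<Delta> id (a \<otimes> t)) * u)"])
      (simp_all add: L L_left A.eval_comult pure_tensor_add_right distrib_left
        mult_scaleC_left mult_scaleC_right)
  have outer: "?L (tensor_assoc (tensor_map \<Delta> id t) * u) = ?L ((1 \<otimes> 1 \<otimes> counit_left \<epsilon> t) * u)"
    for t u
    by (rule additive_tensor_eqI[of "\<lambda>t. ?L (tensor_assoc (tensor_map \<Delta> id t) * u)"])
      (simp_all only: outer, simp_all add: pure_tensor_add_right distrib_right)
  have inner: "?L (tensor_map id (tensor_map id \<Delta>) (x \<otimes> y \<otimes> z) * (1 \<otimes> v)) =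
      eval_pair S \<alpha> (tensor_map id (counit_right \<epsilon>) (x \<otimes> y \<otimes> z)) * cosnake \<delta> T \<gamma> v" for x y z v
    by (rule additive_tensor3_eqI[of
          "\<lambda>v. ?L (tensor_map id (tensor_map id \<Delta>) (x \<otimes> y \<otimes> z) * (1 \<otimes> v))"])
      (simp_all add: L B.eval_pair_mult_pure B.eval_comult pure_tensor_add_right distrib_left
        mult_scaleC_left mult_scaleC_right scaleC_add_right mult.assoc)
  have inner: "?L (tensor_map id (tensor_map id \<Delta>) t * (1 \<otimes> v)) =
      eval_pair S \<alpha> (tensor_map id (counit_right \<epsilon>) t) * cosnake \<delta> T \<gamma> v" for t v
    by (rule additive_tensor3_eqI[of "\<lambda>t. ?L (tensor_map id (tensor_map id \<Delta>) t * (1 \<otimes> v))"])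
      (simp_all only: inner, simp_all add: distrib_right)
  \<comment> \<open>On the other side \<open>(1 \<otimes> \<Delta> \<otimes> 1) \<Phi>\<close> meets \<open>\<delta>\<close>.\<close>
  have L_right: "?L ((x \<otimes> y \<otimes> z \<otimes> 1) * (a \<otimes> tensor_assoc (s \<otimes> c))) =
      S a * S x * \<alpha> * y * coeval_pair \<delta> T s * T z * \<gamma> * c" for x y z a s c
    by (rule additive_tensor_eqI[of
          "\<lambda>s. ?L ((x \<otimes> y \<otimes> z \<otimes> 1) * (a \<otimes> tensor_assoc (s \<otimes> c)))"])
      (simp_all add: pure_tensor_simps distrib_left distrib_right mult.assoc)
  have middle: "?L (tensor_map id tensor_assoc (tensor_assoc (s \<otimes> 1)) *
        tensor_map id tensor_assoc (tensor_map id (tensor_map \<Delta> id) (a \<otimes> b \<otimes> c))) =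
      eval_pair S (snake S \<alpha> \<delta> T s * \<gamma>) (tensor_map id (counit_left \<epsilon>) (a \<otimes> b \<otimes> c))"
    for s a b c
    by (rule additive_tensor3_eqI[of "\<lambda>s. ?L (tensor_map id tensor_assoc (tensor_assoc (s \<otimes> 1)) *
          tensor_map id tensor_assoc (tensor_map id (tensor_map \<Delta> id) (a \<otimes> b \<otimes> c)))"])
      (simp_all add: L_right pure_tensor_add_left distrib_left distrib_right B.coeval_comult
        mult_scaleC_left mult_scaleC_right scaleC_add_right mult.assoc del: tensor_mult_pure)
  have middle: "?L (tensor_map id tensor_assoc (tensor_assoc (s \<otimes> 1)) *
        tensor_map id tensor_assoc (tensor_map id (tensor_map \<Delta> id) t)) =
      eval_pair S (snake S \<alpha> \<delta> T s * \<gamma>) (tensor_map id (counit_left \<epsilon>) t)" for s t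
    by (rule additive_tensor3_eqI[of "\<lambda>t. ?L (tensor_map id tensor_assoc (tensor_assoc (s \<otimes> 1)) *
          tensor_map id tensor_assoc (tensor_map id (tensor_map \<Delta> id) t))"])
      (simp_all only: middle, simp_all add: distrib_left)
  have "tensor_assoc (tensor_map \<Delta> id \<Phi>) * (tensor_map id (tensor_map id \<Delta>) \<Phi> * (1 \<otimes> \<Psi>)) =
      tensor_map id tensor_assoc (tensor_assoc (\<Phi> \<otimes> 1)) *
      tensor_map id tensor_assoc (tensor_map id (tensor_map \<Delta> id) \<Phi>) * ((1 \<otimes> \<Phi>) * (1 \<otimes> \<Psi>))"
    unfolding mult.assoc[symmetric] pentagon ..
  then have "?L (tensor_assoc (tensor_map \<Delta> id \<Phi>) *
        (tensor_map id (tensor_map id \<Delta>) \<Phi> * (1 \<otimes> \<Psi>))) =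
      ?L (tensor_map id tensor_assoc (tensor_assoc (\<Phi> \<otimes> 1)) *
        tensor_map id tensor_assoc (tensor_map id (tensor_map \<Delta> id) \<Phi>))"
    by (simp add: assoc_inverse one_tensor_def[symmetric])
  then show ?thesis
    unfolding outer middle counit_left_coassociator counit_middle
    by (simp add: inner counit_right_coassociator B.cosnake one_tensor_def[symmetric])
      (simp add: one_tensor_def)
qed

text \<open>The mirror image of the preceding argument: the functional \<open>a \<beta> S b \<alpha> c \<delta> T d\<close> is applied to the
  pentagon multiplied from the left by \<open>\<Psi> \<otimes> 1\<close>, which completes the \<open>cosnake\<close> of the first antipode.\<close>

lemma coeval_snake: "\<beta> * snake S \<alpha> \<delta> T \<Phi> = \<delta>"
proof -
  let ?K = "cosnake4 \<beta> S \<alpha> \<delta> T"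
  let ?i = "tensor_map id (\<lambda>y. y \<otimes> 1 \<otimes> 1) :: 'a \<otimes> 'a \<Rightarrow> 'a \<otimes> 'a \<otimes> 'a \<otimes> 'a"
  have K: "?K (x \<otimes> y \<otimes> w) = x * \<beta> * S y * \<alpha> * coeval_pair \<delta> T w" for x y w
    by (rule additive_tensor_eqI[of "\<lambda>w. ?K (x \<otimes> y \<otimes> w)"])
      (simp_all add: pure_tensor_add_right distrib_left mult.assoc)
  \<comment> \<open>The factor \<open>(1 \<otimes> 1 \<otimes> \<Delta>) \<Phi>\<close> meets \<open>\<delta>\<close>, the factor \<open>(\<Delta> \<otimes> 1 \<otimes> 1) \<Phi>\<close> then meets \<open>\<beta>\<close>.\<close>
  have outer: "?K (u * tensor_map id (tensor_map id \<Delta>) (x \<otimes> y \<otimes> z)) =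
      ?K (u * ?i (tensor_map id (counit_right \<epsilon>) (x \<otimes> y \<otimes> z)))" for u x y z
    by (rule additive_tensor4_eqI[of
          "\<lambda>u. ?K (u * tensor_map id (tensor_map id \<Delta>) (x \<otimes> y \<otimes> z))"])
      (simp_all add: K B.coeval_pair_pure_mult B.coeval_comult distrib_right
        mult_scaleC_left mult_scaleC_right mult.assoc)
  have outer: "?K (u * tensor_map id (tensor_map id \<Delta>) t) =
      ?K (u * ?i (tensor_map id (counit_right \<epsilon>) t))" for u t
    by (rule additive_tensor3_eqI[of "\<lambda>t. ?K (u * tensor_map id (tensor_map id \<Delta>) t)"])
      (simp_all only: outer, simp_all add: distrib_left)
  have K_right: "?K ((p \<otimes> q \<otimes> r \<otimes> 1) * tensor_assoc (e \<otimes> w)) =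
      p * coeval_pair \<beta> S e * S q * \<alpha> * r * coeval_pair \<delta> T w" for p q r e w
    by (rule additive_tensor_eqI[of "\<lambda>e. ?K ((p \<otimes> q \<otimes> r \<otimes> 1) * tensor_assoc (e \<otimes> w))"])
      (simp_all add: K B.coeval_pair_pure_mult pure_tensor_add_left distrib_left distrib_right
        mult.assoc)
  have inner: "?K (tensor_map id tensor_assoc (tensor_assoc (s \<otimes> 1)) *
        tensor_assoc (tensor_map \<Delta> id (a \<otimes> w))) =
      cosnake \<beta> S \<alpha> s * coeval_pair \<delta> T (counit_left \<epsilon> (a \<otimes> w))" for s a w
    by (rule additive_tensor3_eqI[of "\<lambda>s. ?K (tensor_map id tensor_assoc (tensor_assoc (s \<otimes> 1)) *
          tensor_assoc (tensor_map \<Delta> id (a \<otimes> w)))"])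
      (simp_all add: K_right pure_tensor_add_left distrib_right A.coeval_comult
        mult_scaleC_left mult_scaleC_right scaleC_add_right mult.assoc del: tensor_mult_pure)
  have inner: "?K (tensor_map id tensor_assoc (tensor_assoc (s \<otimes> 1)) *
        tensor_assoc (tensor_map \<Delta> id t)) =
      cosnake \<beta> S \<alpha> s * coeval_pair \<delta> T (counit_left \<epsilon> t)" for s t
    by (rule additive_tensor_eqI[of "\<lambda>t. ?K (tensor_map id tensor_assoc (tensor_assoc (s \<otimes> 1)) *
          tensor_assoc (tensor_map \<Delta> id t))"])
      (simp_all only: inner, simp_all add: distrib_left)
  \<comment> \<open>On the other side \<open>(1 \<otimes> \<Delta> \<otimes> 1) \<Phi>\<close> meets \<open>\<alpha>\<close>.\<close>
  have K_left: "?K ((a \<otimes> tensor_assoc (e \<otimes> c)) * (1 \<otimes> p \<otimes> q \<otimes> r)) =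
      a * \<beta> * S p * eval_pair S \<alpha> e * q * \<delta> * T r * T c" for a e c p q r
    by (rule additive_tensor_eqI[of
          "\<lambda>e. ?K ((a \<otimes> tensor_assoc (e \<otimes> c)) * (1 \<otimes> p \<otimes> q \<otimes> r))"])
      (simp_all add: pure_tensor_simps distrib_left distrib_right mult.assoc)
  have middle: "?K (tensor_map id tensor_assoc (tensor_map id (tensor_map \<Delta> id) (a \<otimes> b \<otimes> c)) *
        (1 \<otimes> s)) =
      coeval_pair (\<beta> * snake S \<alpha> \<delta> T s) T (tensor_map id (counit_left \<epsilon>) (a \<otimes> b \<otimes> c))"
    for a b c s
    by (rule additive_tensor3_eqI[of "\<lambda>s. ?K (tensor_map id tensor_assoc
          (tensor_map id (tensor_map \<Delta> id) (a \<otimes> b \<otimes> c)) * (1 \<otimes> s))"])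
      (simp_all add: K_left pure_tensor_add_right distrib_left distrib_right A.eval_comult
        mult_scaleC_left mult_scaleC_right scaleC_add_right mult.assoc del: tensor_mult_pure)
  have middle: "?K (tensor_map id tensor_assoc (tensor_map id (tensor_map \<Delta> id) t) * (1 \<otimes> s)) =
      coeval_pair (\<beta> * snake S \<alpha> \<delta> T s) T (tensor_map id (counit_left \<epsilon>) t)" for s t
    by (rule additive_tensor3_eqI[of "\<lambda>t. ?K (tensor_map id tensor_assoc
          (tensor_map id (tensor_map \<Delta> id) t) * (1 \<otimes> s))"])
      (simp_all only: middle, simp_all add: distrib_right)
  let ?j = "\<lambda>s :: 'a \<otimes> 'a \<otimes> 'a.
    tensor_map id tensor_assoc (tensor_assoc (s \<otimes> (1::'a))) :: 'a \<otimes> 'a \<otimes> 'a \<otimes> 'a"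
  have "?j \<Psi> * ?j \<Phi> = ?j (\<Psi> * \<Phi>)"
    by (simp add: tensor_map_mult[symmetric] tensor_assoc_mult[symmetric])
  then have j: "?j \<Psi> * ?j \<Phi> = 1"
    by (simp add: assoc_inverse one_tensor_def[symmetric])
  have "?j \<Psi> * tensor_assoc (tensor_map \<Delta> id \<Phi>) * tensor_map id (tensor_map id \<Delta>) \<Phi> =
      (?j \<Psi> * ?j \<Phi>) * (tensor_map id tensor_assoc (tensor_map id (tensor_map \<Delta> id) \<Phi>) *
      (1 \<otimes> \<Phi>))"
    unfolding mult.assoc pentagon ..
  then have "?K (?j \<Psi> * tensor_assoc (tensor_map \<Delta> id \<Phi>) * tensor_map id (tensor_map id \<Delta>) \<Phi>) =
      ?K (tensor_map id tensor_assoc (tensor_map id (tensor_map \<Delta> id) \<Phi>) * (1 \<otimes> \<Phi>))"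
    by (simp only: j mult_1_left)
  moreover have "?i 1 = 1"
    by (simp add: one_tensor_def)
  ultimately show ?thesis
    unfolding outer middle counit_right_coassociator counit_middle
    by (simp add: inner counit_left_coassociator A.cosnake) (simp add: one_tensor_def)
qed

end

lemma two_quasi_antipodes_swap:
  "quasi_bialgebra_two_antipodes \<epsilon> \<Delta> \<Phi> \<Psi> S \<alpha> \<beta> T \<gamma> \<delta> \<Longrightarrow>
    quasi_bialgebra_two_antipodes \<epsilon> \<Delta> \<Phi> \<Psi> T \<gamma> \<delta> S \<alpha> \<beta>"
  by (simp add: quasi_bialgebra_two_antipodes_def two_quasi_antipodes_def)

text \<open>An intertwiner multiplied at the end of a snake can be moved through the antipode there and is
  swallowed by the coevaluation.\<close>

lemma snake_change_antipode:
  assumes [simp]: "clinear R" "clinear S" "clinear T"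
    and w: "\<beta> * w = \<delta>" "\<And>a. S a * w = w * T a"
  shows "snake R \<alpha> \<beta> S t * w = snake R \<alpha> \<delta> T t"
proof (rule additive_tensor3_eqI[of "\<lambda>t. snake R \<alpha> \<beta> S t * w"])
  fix x y z
  have "R x * \<alpha> * y * (\<beta> * (S z * w)) = R x * \<alpha> * y * ((\<beta> * w) * T z)"
    by (simp add: w(2) mult.assoc)
  then show "snake R \<alpha> \<beta> S (x \<otimes> y \<otimes> z) * w = snake R \<alpha> \<delta> T (x \<otimes> y \<otimes> z)"
    by (simp add: w(1) mult.assoc)
qed (simp_all add: distrib_right)

context quasi_bialgebra_two_antipodes
begin

interpretation swap: quasi_bialgebra_two_antipodes \<epsilon> \<Delta> \<Phi> \<Psi> T \<gamma> \<delta> S \<alpha> \<beta>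
  by (rule two_quasi_antipodes_swap) (rule quasi_bialgebra_two_antipodes_axioms)

text \<open>Since the second factor satisfies the intertwining relations in the opposite direction, it turns
  the mixed snake into the snake of \<open>S\<close> alone, which is 1.\<close>

lemma snake_inverse: "snake S \<alpha> \<delta> T \<Phi> * snake T \<gamma> \<beta> S \<Phi> = 1"
  using snake_change_antipode[of S T S \<delta> "snake T \<gamma> \<beta> S \<Phi>" \<beta> \<alpha> \<Phi>] A.snake
  by (simp add: swap.coeval_snake swap.snake_intertwines)

end

definition antipode_intertwiner :: "('a \<Rightarrow> 'a) \<Rightarrow> 'a \<Rightarrow> 'a \<Rightarrow> ('a \<Rightarrow> 'a) \<Rightarrow> 'a \<Rightarrow> 'a \<Rightarrow>
    'a::complex_algebra_1 \<Rightarrow> bool" where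
  "antipode_intertwiner S \<alpha> \<beta> T \<gamma> \<delta> w \<longleftrightarrow> has_inverse w \<and> w * \<gamma> = \<alpha> \<and> \<beta> * w = \<delta> \<and>
    (\<forall>a. S a = w * T a * inverse_of w)"

context quasi_bialgebra_two_antipodes
begin

lemma snake_sum: "snake S \<alpha> \<delta> T (\<Sum>i\<in>I. X i \<otimes> Y i \<otimes> Z i) =
    (\<Sum>i\<in>I. S (X i) * \<alpha> * Y i * \<delta> * T (Z i))"
  by (subst additive_sum_eq[of "snake S \<alpha> \<delta> T"]) simp_all

interpretation swap: quasi_bialgebra_two_antipodes \<epsilon> \<Delta> \<Phi> \<Psi> T \<gamma> \<delta> S \<alpha> \<beta>
  by (rule two_quasi_antipodes_swap) (rule quasi_bialgebra_two_antipodes_axioms)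

theorem antipode_intertwiner_snake:
  "antipode_intertwiner S \<alpha> \<beta> T \<gamma> \<delta> (snake S \<alpha> \<delta> T \<Phi>)"
proof -
  let ?w = "snake S \<alpha> \<delta> T \<Phi>" and ?v = "snake T \<gamma> \<beta> S \<Phi>"
  have inv: "?w * ?v = 1" "?v * ?w = 1"
    by (rule snake_inverse swap.snake_inverse)+
  then have "?w * T a * inverse_of ?w = S a" for a
    by (simp add: inverse_of_eqI[OF inv] snake_intertwines[symmetric] mult.assoc)
  with inv show ?thesis
    by (auto simp: antipode_intertwiner_def has_inverse_def snake_eval coeval_snake)
qed

lemma antipode_intertwiner_swap:
  assumes w: "antipode_intertwiner S \<alpha> \<beta> T \<gamma> \<delta> w"
  shows "antipode_intertwiner T \<gamma> \<delta> S \<alpha> \<beta> (inverse_of w)"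
proof -
  have w': "has_inverse w" "\<alpha> = w * \<gamma>" "\<delta> = \<beta> * w" "S a = w * T a * inverse_of w" for a
    using w by (auto simp: antipode_intertwiner_def)
  note inv = has_inverse[OF w'(1)]
  have cancel: "inverse_of w * (w * x) = x" "w * (inverse_of w * x) = x" for x
    by (simp_all add: inv mult.assoc[symmetric])
  have "inverse_of (inverse_of w) = w"
    by (rule inverse_of_eqI) (rule inv)+
  then show ?thesis
    using inv by (auto simp: antipode_intertwiner_def has_inverse_def w'(2-4) cancel mult.assoc)
qed

text \<open>Multiplied by \<open>w\<close>, the triangle identity \<open>snake S \<alpha> \<beta> S \<Phi> = 1\<close> turns into the mixed snake, which
  does not involve \<open>w\<close>.\<close>

theorem antipode_intertwiner_unique:
  assumes w: "antipode_intertwiner S \<alpha> \<beta> T \<gamma> \<delta> w"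
  shows "w = snake S \<alpha> \<delta> T \<Phi>"
proof -
  have "S a * w = w * T a" for a
    using w has_inverse(2)[of w] by (simp add: antipode_intertwiner_def mult.assoc)
  then show ?thesis
    using snake_change_antipode[of S S T \<beta> w \<delta> \<alpha> \<Phi>] A.snake w
    by (simp add: antipode_intertwiner_def)
qed

lemma antipode_intertwiner_inverse:
  "antipode_intertwiner S \<alpha> \<beta> T \<gamma> \<delta> w \<Longrightarrow> inverse_of w = snake T \<gamma> \<beta> S \<Phi>"
  by (rule quasi_bialgebra_two_antipodes.antipode_intertwiner_unique[OF
        two_quasi_antipodes_swap[OF quasi_bialgebra_two_antipodes_axioms]])
    (rule antipode_intertwiner_swap)

text \<open>The map \<open>S \<circ> inv T\<close> is conjugation by \<open>w\<close>. Hence the conjugating factors telescope and each sum is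
  the \<open>cosnake\<close> of \<open>S\<close> multiplied by \<open>w\<close> on the left or by its inverse on the right.\<close>

lemma antipode_intertwiner_cosnake:
  assumes w: "antipode_intertwiner S \<alpha> \<beta> T \<gamma> \<delta> w" and T: "surj T"
    and \<Psi>: "\<Psi> = (\<Sum>i\<in>I. X i \<otimes> Y i \<otimes> Z i)"
  shows "w = (\<Sum>i\<in>I. S (inv T (X i)) * S (inv T \<delta>) * S (Y i) * \<alpha> * Z i)"
    and "inverse_of w = (\<Sum>i\<in>I. X i * \<beta> * S (Y i) * S (inv T \<gamma>) * S (inv T (Z i)))"
proof -
  have w': "\<delta> = \<beta> * w" "\<alpha> = w * \<gamma>" "has_inverse w"
    using w by (auto simp: antipode_intertwiner_def)
  note inv = has_inverse[OF w'(3)]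
  have cancel: "inverse_of w * (w * x) = x" "w * (inverse_of w * x) = x" for x
    by (simp_all add: inv mult.assoc[symmetric])
  have conj: "S (inv T a) = w * (a * inverse_of w)" for a
    using w surj_f_inv_f[OF T, of a] by (simp add: antipode_intertwiner_def mult.assoc)
  have sum: "(\<Sum>i\<in>I. X i * (\<beta> * (S (Y i) * (\<alpha> * Z i)))) = 1"
    using A.cosnake additive_sum_eq[of "cosnake \<beta> S \<alpha>" "\<lambda>i. X i \<otimes> Y i \<otimes> Z i" I]
    by (simp add: \<Psi> mult.assoc)
  have "(\<Sum>i\<in>I. S (inv T (X i)) * S (inv T \<delta>) * S (Y i) * \<alpha> * Z i) =
      (\<Sum>i\<in>I. w * (X i * (\<beta> * (S (Y i) * (\<alpha> * Z i)))))"
    by (simp only: conj w'(1) mult.assoc cancel inv mult_1_right)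
  also have "\<dots> = w"
    by (simp add: sum_distrib_left[symmetric] sum)
  finally show "w = (\<Sum>i\<in>I. S (inv T (X i)) * S (inv T \<delta>) * S (Y i) * \<alpha> * Z i)" ..
  have "(\<Sum>i\<in>I. X i * \<beta> * S (Y i) * S (inv T \<gamma>) * S (inv T (Z i))) =
      (\<Sum>i\<in>I. X i * (\<beta> * (S (Y i) * (\<alpha> * Z i))) * inverse_of w)"
    by (simp only: conj w'(2) mult.assoc cancel)
  also have "\<dots> = inverse_of w"
    by (simp add: sum_distrib_right[symmetric] sum)
  finally show "inverse_of w =
      (\<Sum>i\<in>I. X i * \<beta> * S (Y i) * S (inv T \<gamma>) * S (inv T (Z i)))" ..
qed

end

section \<open>Twisting a quasi-antipode\<close>

context quasi_antipode
begin

lemma eval_pair_twist: "eval_pair S (eval_pair S \<alpha> G) t = eval_pair S \<alpha> (G * t)"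
  by (rule additive_tensor_eqI[of "eval_pair S (eval_pair S \<alpha> G)"])
    (simp_all add: eval_pair_mult_pure distrib_left)

lemma coeval_pair_twist: "coeval_pair (coeval_pair \<beta> S F) S t = coeval_pair \<beta> S (t * F)"
  by (rule additive_tensor_eqI[of "coeval_pair (coeval_pair \<beta> S F) S"])
    (simp_all add: coeval_pair_pure_mult distrib_right)

lemma eval_pair_comult_mult: "eval_pair S \<alpha> (\<Delta> a * t) = \<epsilon> a *\<^sub>C eval_pair S \<alpha> t"
  by (rule additive_tensor_eqI[of "\<lambda>t. eval_pair S \<alpha> (\<Delta> a * t)"])
    (simp_all add: eval_pair_mult_pure eval_comult distrib_left scaleC_add_right
      mult_scaleC_left mult_scaleC_right)

lemma coeval_pair_mult_comult: "coeval_pair \<beta> S (t * \<Delta> a) = \<epsilon> a *\<^sub>C coeval_pair \<beta> S t"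
  by (rule additive_tensor_eqI[of "\<lambda>t. coeval_pair \<beta> S (t * \<Delta> a)"])
    (simp_all add: coeval_pair_pure_mult coeval_comult distrib_right scaleC_add_right
      mult_scaleC_left mult_scaleC_right)

text \<open>The factors by which a twist changes \<open>\<alpha>\<close> and \<open>\<beta>\<close> can instead be multiplied to the argument. There
  they will cancel the outer factors of the twisted co-associator.\<close>

lemma snake_twist:
  "snake S (eval_pair S \<alpha> G) (coeval_pair \<beta> S F) S t =
    snake S \<alpha> \<beta> S (tensor_assoc (G \<otimes> 1) * t * (1 \<otimes> F))"
proof (rule additive_tensor3_eqI[of "snake S (eval_pair S \<alpha> G) (coeval_pair \<beta> S F) S"])
  fix x y z
  have pure: "S x * (S g * \<alpha> * h) * y * coeval_pair \<beta> S F * S z =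
      snake S \<alpha> \<beta> S (((g * x) \<otimes> (h * y) \<otimes> z) * (1 \<otimes> F))" for g h
    by (rule additive_tensor_eqI[of "\<lambda>F. S x * (S g * \<alpha> * h) * y * coeval_pair \<beta> S F * S z"])
      (simp_all add: pure_tensor_add_right distrib_left distrib_right mult.assoc)
  show "snake S (eval_pair S \<alpha> G) (coeval_pair \<beta> S F) S (x \<otimes> y \<otimes> z) =
      snake S \<alpha> \<beta> S (tensor_assoc (G \<otimes> 1) * (x \<otimes> y \<otimes> z) * (1 \<otimes> F))"
    by (rule additive_tensor_eqI[of
          "\<lambda>G. snake S (eval_pair S \<alpha> G) (coeval_pair \<beta> S F) S (x \<otimes> y \<otimes> z)"
          "\<lambda>G. snake S \<alpha> \<beta> S (tensor_assoc (G \<otimes> 1) * (x \<otimes> y \<otimes> z) * (1 \<otimes> F))"])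
      (simp_all add: pure pure_tensor_add_left distrib_left distrib_right)
qed (simp_all add: distrib_left distrib_right)

lemma cosnake_twist:
  "cosnake (coeval_pair \<beta> S F) S (eval_pair S \<alpha> G) t =
    cosnake \<beta> S \<alpha> ((1 \<otimes> G) * t * tensor_assoc (F \<otimes> 1))"
proof (rule additive_tensor3_eqI[of "cosnake (coeval_pair \<beta> S F) S (eval_pair S \<alpha> G)"])
  fix x y z
  have pure: "x * (f * \<beta> * S k) * S y * eval_pair S \<alpha> G * z =
      cosnake \<beta> S \<alpha> ((1 \<otimes> G) * ((x * f) \<otimes> (y * k) \<otimes> z))" for f k
    by (rule additive_tensor_eqI[of "\<lambda>G. x * (f * \<beta> * S k) * S y * eval_pair S \<alpha> G * z"])
      (simp_all add: pure_tensor_add_right distrib_left distrib_right mult.assoc)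
  show "cosnake (coeval_pair \<beta> S F) S (eval_pair S \<alpha> G) (x \<otimes> y \<otimes> z) =
      cosnake \<beta> S \<alpha> ((1 \<otimes> G) * (x \<otimes> y \<otimes> z) * tensor_assoc (F \<otimes> 1))"
    by (rule additive_tensor_eqI[of
          "\<lambda>F. cosnake (coeval_pair \<beta> S F) S (eval_pair S \<alpha> G) (x \<otimes> y \<otimes> z)"
          "\<lambda>F. cosnake \<beta> S \<alpha> ((1 \<otimes> G) * (x \<otimes> y \<otimes> z) * tensor_assoc (F \<otimes> 1))"])
      (simp_all add: pure pure_tensor_add_left distrib_left distrib_right
        mult.assoc[of G])
qed (simp_all add: distrib_left distrib_right)

text \<open>After the cancellation the triangle identities still contain \<open>(\<Delta> \<otimes> 1) F\<close> and \<open>(1 \<otimes> \<Delta>) G\<close>, or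
  \<open>(1 \<otimes> \<Delta>) F\<close> and \<open>(\<Delta> \<otimes> 1) G\<close>; these are absorbed at \<open>\<alpha>\<close> and \<open>\<beta>\<close> and leave counits of
  \<open>F\<close> and \<open>G\<close>, which are 1.\<close>

theorem quasi_antipode_twist:
  assumes F: "F * G = 1" "G * F = 1" "counit_left \<epsilon> F = 1" "counit_right \<epsilon> F = 1"
  shows "quasi_antipode \<epsilon> (\<lambda>a. F * \<Delta> a * G)
    (tensor_assoc (F \<otimes> 1) * tensor_assoc (tensor_map \<Delta> id F) * \<Phi> *
      tensor_map id \<Delta> G * (1 \<otimes> G))
    ((1 \<otimes> F) * tensor_map id \<Delta> F * \<Psi> * tensor_assoc (tensor_map \<Delta> id G) *
      tensor_assoc (G \<otimes> 1))
    S (eval_pair S \<alpha> G) (coeval_pair \<beta> S F)"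
proof
  interpret two_quasi_antipodes \<epsilon> \<Delta> \<Phi> \<Psi> S \<alpha> \<beta> S \<alpha> \<beta>
    by (simp add: two_quasi_antipodes_def quasi_antipode_axioms)
  have G: "counit_left \<epsilon> G = 1" "counit_right \<epsilon> G = 1"
    using F(3,4) arg_cong[OF F(1), of "counit_left \<epsilon>"] arg_cong[OF F(1), of "counit_right \<epsilon>"]
    by simp_all
  have assoc_mult: "tensor_assoc (s \<otimes> 1) * tensor_assoc (t \<otimes> 1) = tensor_assoc ((s * t) \<otimes> 1)"
    for s t :: "'a \<otimes> 'a"
    by (simp add: tensor_assoc_mult[symmetric])
  have cancel: "tensor_assoc (G \<otimes> (1::'a)) * (tensor_assoc (F \<otimes> 1) * t) = t"
    "((1::'a) \<otimes> G) * ((1 \<otimes> F) * t) = t" for t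
    unfolding mult.assoc[symmetric] assoc_mult
    by (simp_all add: F one_tensor_def[symmetric])
  have cancel': "tensor_assoc (G \<otimes> (1::'a)) * tensor_assoc (F \<otimes> 1) = 1"
    "((1::'a) \<otimes> G) * (1 \<otimes> F) = 1"
    unfolding assoc_mult by (simp_all add: F one_tensor_def[symmetric])
  have "tensor_assoc (G \<otimes> (1::'a)) * (tensor_assoc (F \<otimes> 1) * tensor_assoc (tensor_map \<Delta> id F) *
      \<Phi> * tensor_map id \<Delta> G * (1 \<otimes> G)) * (1 \<otimes> F) =
      tensor_assoc (tensor_map \<Delta> id F) * (\<Phi> * tensor_map id \<Delta> G)"
    by (simp only: mult.assoc cancel cancel' mult_1_right)
  then show "snake S (eval_pair S \<alpha> G) (coeval_pair \<beta> S F) S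
      (tensor_assoc (F \<otimes> 1) * tensor_assoc (tensor_map \<Delta> id F) * \<Phi> *
        tensor_map id \<Delta> G * (1 \<otimes> G)) = 1"
    by (simp add: snake_twist snake_comult_left snake_comult_right snake F G)
  have "(1 \<otimes> G) * ((1 \<otimes> F) * tensor_map id \<Delta> F * \<Psi> * tensor_assoc (tensor_map \<Delta> id G) *
      tensor_assoc (G \<otimes> (1::'a))) * tensor_assoc (F \<otimes> 1) =
      tensor_map id \<Delta> F * (\<Psi> * tensor_assoc (tensor_map \<Delta> id G))"
    by (simp only: mult.assoc cancel cancel' mult_1_right)
  then show "cosnake (coeval_pair \<beta> S F) S (eval_pair S \<alpha> G)
      ((1 \<otimes> F) * tensor_map id \<Delta> F * \<Psi> * tensor_assoc (tensor_map \<Delta> id G) *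
        tensor_assoc (G \<otimes> 1)) = 1"
    by (simp add: cosnake_twist cosnake_comult_left cosnake_comult_right cosnake F G)
  show "algebra_hom (\<lambda>a. F * \<Delta> a * G)"
  proof -
    have "F * \<Delta> x * G * (F * \<Delta> y * G) = F * \<Delta> x * ((G * F) * (\<Delta> y * G))" for x y
      by (simp only: mult.assoc)
    then show ?thesis by (simp add: algebra_hom_def F mult.assoc)
  qed
  fix a
  have "G * (F * \<Delta> a * G) = (G * F) * (\<Delta> a * G)" "F * \<Delta> a * G * F = F * \<Delta> a * (G * F)"
    by (simp_all only: mult.assoc)
  then show "eval_pair S (eval_pair S \<alpha> G) (F * \<Delta> a * G) = \<epsilon> a *\<^sub>C eval_pair S \<alpha> G"
    and "coeval_pair (coeval_pair \<beta> S F) S (F * \<Delta> a * G) = \<epsilon> a *\<^sub>C coeval_pair \<beta> S F"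
    by (simp_all add: F eval_pair_twist coeval_pair_twist eval_pair_comult_mult
        coeval_pair_mult_comult)
qed (rule counit_hom antihom)+

end

section \<open>Conjugating a quasi-bialgebra\<close>

lemma antilinear_tensor_map [simp]:
  assumes "antilinear f" and "antilinear g"
  shows "antilinear (tensor_map f g)"
proof -
  have bal: "balanced (\<lambda>a b. f a \<otimes> g b)"
    using assms by (intro balancedI) (simp_all add: antilinear_def pure_tensor_simps)
  show ?thesis
    using assms unfolding antilinear_def tensor_map_def
    by (auto intro!: tensor_lift_add[OF bal] tensor_lift_scaleC[OF bal]
        simp: pure_tensor_scaleC_left)
qed

lemma antilinear_add: "antilinear f \<Longrightarrow> f (x + y) = f x + f y"
  and antilinear_scaleC: "antilinear f \<Longrightarrow> f (c *\<^sub>C x) = cnj c *\<^sub>C f x"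
  by (simp_all add: antilinear_def)

lemma tensor_map_add_antilinear [simp]:
  "antilinear f \<Longrightarrow> antilinear g \<Longrightarrow> tensor_map f g (s + t) = tensor_map f g s + tensor_map f g t"
  by (rule antilinear_add) simp

declare tensor_map_pure_antilinear [simp]

lemma conjugation_simps:
  assumes "conjugation f"
  shows "antilinear f" "f (f a) = a" "f (a * b) = f b * f a" "f 1 = 1"
proof -
  show f: "antilinear f" "f (f a) = a" "f (a * b) = f b * f a" for a b
    using assms by (simp_all add: conjugation_def)
  show "f 1 = 1"
    using f(2,3)[of 1] f(2)[of "f 1"] f(3)[of "f 1" 1] by simp
qed

text \<open>The extension of a conjugation to tensor powers reverses products in every leg and hence in the
  tensor product, so it is a conjugation again.\<close>

lemma conjugation_tensor_map:
  assumes f: "conjugation f" and g: "conjugation g"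
  shows "conjugation (tensor_map f g)"
proof -
  note fg = conjugation_simps[OF f] conjugation_simps[OF g]
  have inv: "tensor_map f g (tensor_map f g t) = t" for t
    by (rule additive_tensor_eqI[of "\<lambda>t. tensor_map f g (tensor_map f g t)"])
      (simp_all add: fg)
  have mult: "tensor_map f g ((a \<otimes> b) * t) = tensor_map f g t * tensor_map f g (a \<otimes> b)" for a b t
    by (rule additive_tensor_eqI[of "\<lambda>t. tensor_map f g ((a \<otimes> b) * t)"])
      (simp_all add: fg distrib_left distrib_right)
  have "tensor_map f g (s * t) = tensor_map f g t * tensor_map f g s" for s t
    by (rule additive_tensor_eqI[of "\<lambda>s. tensor_map f g (s * t)"])
      (simp_all only: mult, simp_all add: fg distrib_left distrib_right)
  with inv show ?thesis by (simp add: conjugation_def fg)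
qed

lemma tensor_assoc_antilinear:
  assumes [simp]: "antilinear f" "antilinear g" "antilinear h"
  shows "tensor_assoc (tensor_map f g s \<otimes> h t) =
    tensor_map f (tensor_map g h) (tensor_assoc (s \<otimes> t))"
  by (rule additive_tensor_eqI[of "\<lambda>s. tensor_assoc (tensor_map f g s \<otimes> h t)"])
    (simp_all add: pure_tensor_add_left)

lemma algebra_hom_compose: "algebra_hom f \<Longrightarrow> algebra_hom g \<Longrightarrow> algebra_hom (\<lambda>x. f (g x))"
  by (simp add: algebra_hom_def clinear_compose)

lemma algebra_hom_unit_tensor:
  "algebra_hom (\<lambda>t. 1 \<otimes> t)" "algebra_hom (\<lambda>t. t \<otimes> 1)"
  by (simp_all add: algebra_hom_def one_tensor_def)

locale conjugated_comultiplication = augmented_comultiplication \<epsilon> \<Delta>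
  for \<epsilon> :: "'a::complex_algebra_1 \<Rightarrow> complex" and \<Delta> :: "'a \<Rightarrow> 'a \<otimes> 'a" +
  fixes dag :: "'a \<Rightarrow> 'a"
  assumes conjugation: "conjugation dag" and counit_dag: "\<epsilon> (dag a) = cnj (\<epsilon> a)"
begin

abbreviation dag2 :: "'a \<otimes> 'a \<Rightarrow> 'a \<otimes> 'a" where
  "dag2 \<equiv> tensor_map dag dag"

abbreviation dag3 :: "'a \<otimes> 'a \<otimes> 'a \<Rightarrow> 'a \<otimes> 'a \<otimes> 'a" where
  "dag3 \<equiv> tensor_map dag dag2"

abbreviation dag4 :: "'a \<otimes> 'a \<otimes> 'a \<otimes> 'a \<Rightarrow> 'a \<otimes> 'a \<otimes> 'a \<otimes> 'a" where
  "dag4 \<equiv> tensor_map dag dag3"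

text \<open>The comultiplication transported along the conjugation; in a quasi-Hopf star algebra it is the
  comultiplication twisted by the canonical element.\<close>

definition comult_dag :: "'a \<Rightarrow> 'a \<otimes> 'a" where
  "comult_dag a = dag2 (\<Delta> (dag a))"

lemmas conj = conjugation conjugation_tensor_map[OF conjugation conjugation]
  conjugation_tensor_map[OF conjugation conjugation_tensor_map[OF conjugation conjugation]]
  conjugation_tensor_map[OF conjugation
    conjugation_tensor_map[OF conjugation conjugation_tensor_map[OF conjugation conjugation]]]

lemmas dag_simps [simp] = conj[THEN conjugation_simps(1)] conj[THEN conjugation_simps(2)]
  conj[THEN conjugation_simps(3)] conj[THEN conjugation_simps(4)]
  conj(1)[THEN conjugation_simps(1), THEN antilinear_add]
  conj(1)[THEN conjugation_simps(1), THEN antilinear_scaleC]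
  conj(2)[THEN conjugation_simps(1), THEN antilinear_scaleC]

lemma comult_dag_dag [simp]: "comult_dag (dag a) = dag2 (\<Delta> a)"
  by (simp add: comult_dag_def)

lemma comult_dag_hom: "algebra_hom comult_dag"
  by (auto simp: algebra_hom_def comult_dag_def clinear_scaleC intro!: clinearI)

lemma comult_dag_clinear [simp]: "clinear comult_dag"
  using comult_dag_hom by (simp add: algebra_hom_def)

lemma counit_left_dag: "counit_left \<epsilon> (tensor_map dag f t) = f (counit_left \<epsilon> t)"
  if "antilinear f" for f :: "'b::complex_vector \<Rightarrow> 'b"
  by (rule additive_tensor_eqI[of "\<lambda>t. counit_left \<epsilon> (tensor_map dag f t)"])
    (simp_all add: that counit_dag antilinear_add antilinear_scaleC)

lemma counit_right_dag: "counit_right \<epsilon> (dag2 t) = dag (counit_right \<epsilon> t)"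
  by (rule additive_tensor_eqI[of "\<lambda>t. counit_right \<epsilon> (dag2 t)"])
    (simp_all add: counit_dag)

end

locale conjugated_quasi_bialgebra =
  quasi_bialgebra \<epsilon> \<Delta> \<Phi> \<Psi> + conjugated_comultiplication \<epsilon> \<Delta> dag
  for \<epsilon> :: "'a::complex_algebra_1 \<Rightarrow> complex" and \<Delta> \<Phi> \<Psi> dag
begin

text \<open>Conjugation commutes with all operations on legs once \<open>\<Delta>\<close> is replaced by its transport, but it
  reverses products. Therefore it carries the inverse of each axiom for \<open>\<Phi>\<close> to that axiom for the
  conjugate of \<open>\<Psi>\<close>.\<close>

theorem quasi_bialgebra_dag: "quasi_bialgebra \<epsilon> comult_dag (dag3 \<Psi>) (dag3 \<Phi>)"
proof
  let ?j = "\<lambda>s :: 'a \<otimes> 'a \<otimes> 'a.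
    tensor_map id tensor_assoc (tensor_assoc (s \<otimes> (1::'a))) :: 'a \<otimes> 'a \<otimes> 'a \<otimes> 'a"
  let ?m = "\<lambda>\<Delta> (t :: 'a \<otimes> 'a \<otimes> 'a).
    tensor_map id tensor_assoc (tensor_map id (tensor_map \<Delta> id) t) :: 'a \<otimes> 'a \<otimes> 'a \<otimes> 'a"
  have left2: "tensor_assoc (tensor_map comult_dag id (dag2 t)) =
      dag3 (tensor_assoc (tensor_map \<Delta> id t))" for t
    by (rule additive_tensor_eqI[of "\<lambda>t. tensor_assoc (tensor_map comult_dag id (dag2 t))"])
      (simp_all add: tensor_assoc_antilinear)
  have right2: "tensor_map id comult_dag (dag2 t) = dag3 (tensor_map id \<Delta> t)" for t
    by (rule additive_tensor_eqI[of "\<lambda>t. tensor_map id comult_dag (dag2 t)"]) simp_all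
  have left: "tensor_assoc (tensor_map comult_dag id (dag3 t)) =
      dag4 (tensor_assoc (tensor_map \<Delta> id t))" for t
    by (rule additive_tensor_eqI[of "\<lambda>t. tensor_assoc (tensor_map comult_dag id (dag3 t))"])
      (simp_all add: tensor_assoc_antilinear)
  have right: "tensor_map id (tensor_map id comult_dag) (dag3 t) =
      dag4 (tensor_map id (tensor_map id \<Delta>) t)" for t
    by (rule additive_tensor3_eqI[of "\<lambda>t. tensor_map id (tensor_map id comult_dag) (dag3 t)"])
      simp_all
  have middle: "?m comult_dag (dag3 t) = dag4 (?m \<Delta> t)" for t
    by (rule additive_tensor3_eqI[of "\<lambda>t. ?m comult_dag (dag3 t)"])
      (simp_all add: tensor_assoc_antilinear)
  have j_dag: "?j (dag3 t) = dag4 (?j t)" for t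
    by (rule additive_tensor3_eqI[of "\<lambda>t. ?j (dag3 t)"]) (simp_all add: pure_tensor_add_left)
  have one_dag: "1 \<otimes> dag3 t = dag4 (1 \<otimes> t)" for t
    by simp
  have inverse: "f \<Phi> * f \<Psi> = 1" "f \<Psi> * f \<Phi> = 1" if "algebra_hom f"
    for f :: "'a \<otimes> 'a \<otimes> 'a \<Rightarrow> 'a \<otimes> 'a \<otimes> 'a \<otimes> 'a"
    using that arg_cong[OF assoc_inverse(1), of f] arg_cong[OF assoc_inverse(2), of f]
    by (simp_all add: algebra_hom_def)
  let ?l = "\<lambda>t :: 'a \<otimes> 'a \<otimes> 'a. tensor_assoc (tensor_map \<Delta> id t)"
  let ?r = "\<lambda>t :: 'a \<otimes> 'a \<otimes> 'a. tensor_map id (tensor_map id \<Delta>) t"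
  have l: "?l \<Phi> * ?l \<Psi> = 1"
    by (rule inverse(1)[OF algebra_hom_compose[OF algebra_hom_tensor_assoc
            algebra_hom_tensor_map[OF comult_hom algebra_hom_id]]])
  have r: "?r \<Phi> * ?r \<Psi> = 1"
    by (intro inverse(1) algebra_hom_tensor_map comult_hom algebra_hom_id)
  note rebracket = algebra_hom_tensor_map[OF algebra_hom_id algebra_hom_tensor_assoc]
  have j: "?j \<Psi> * ?j \<Phi> = 1"
    by (rule inverse(2)[OF algebra_hom_compose[OF rebracket
            algebra_hom_compose[OF algebra_hom_tensor_assoc algebra_hom_unit_tensor(2)]]])
  have m: "?m \<Delta> \<Psi> * ?m \<Delta> \<Phi> = 1"
    by (rule inverse(2)[OF algebra_hom_compose[OF rebracket algebra_hom_tensor_map[OF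
              algebra_hom_id algebra_hom_tensor_map[OF comult_hom algebra_hom_id]]]])
  have u: "(1 \<otimes> \<Psi>) * (1 \<otimes> \<Phi>) = (1 :: 'a \<otimes> 'a \<otimes> 'a \<otimes> 'a)"
    by (rule inverse(2)[OF algebra_hom_unit_tensor(1)])
  \<comment> \<open>The two sides of the pentagon are inverted factor by factor; as the sides agree, so do the inverses.\<close>
  have "(?l \<Phi> * ?r \<Phi>) * (?r \<Psi> * ?l \<Psi>) = ?l \<Phi> * ((?r \<Phi> * ?r \<Psi>) * ?l \<Psi>)"
    by (simp only: mult.assoc)
  then have "?j \<Phi> * ?m \<Delta> \<Phi> * (1 \<otimes> \<Phi>) * (?r \<Psi> * ?l \<Psi>) = 1"
    by (simp only: l r mult_1_left pentagon)
  then have "(1 \<otimes> \<Psi>) * (?m \<Delta> \<Psi> * ?j \<Psi>) =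
      (1 \<otimes> \<Psi>) * (?m \<Delta> \<Psi> * ((?j \<Psi> * ?j \<Phi>) * (?m \<Delta> \<Phi> * ((1 \<otimes> \<Phi>) * (?r \<Psi> * ?l \<Psi>)))))"
    by (simp only: mult.assoc) simp
  also have "\<dots> = (1 \<otimes> \<Psi>) * ((?m \<Delta> \<Psi> * ?m \<Delta> \<Phi>) * ((1 \<otimes> \<Phi>) * (?r \<Psi> * ?l \<Psi>)))"
    by (simp only: j mult_1_left mult.assoc)
  also have "\<dots> = ((1 \<otimes> \<Psi>) * (1 \<otimes> \<Phi>)) * (?r \<Psi> * ?l \<Psi>)"
    by (simp only: m mult_1_left mult.assoc)
  finally have "?r \<Psi> * ?l \<Psi> = (1 \<otimes> \<Psi>) * (?m \<Delta> \<Psi> * ?j \<Psi>)"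
    by (simp only: u mult_1_left)
  then have "dag4 (?r \<Psi> * ?l \<Psi>) = dag4 ((1 \<otimes> \<Psi>) * (?m \<Delta> \<Psi> * ?j \<Psi>))"
    by (rule arg_cong)
  then show "tensor_assoc (tensor_map comult_dag id (dag3 \<Psi>)) *
      tensor_map id (tensor_map id comult_dag) (dag3 \<Psi>) =
      ?j (dag3 \<Psi>) * ?m comult_dag (dag3 \<Psi>) * (1 \<otimes> dag3 \<Psi>)"
    by (simp only: left right middle j_dag one_dag conj(4)[THEN conjugation_simps(3)])
  show "dag3 \<Psi> * dag3 \<Phi> = 1" "dag3 \<Phi> * dag3 \<Psi> = 1"
    using arg_cong[OF assoc_inverse(1), of dag3] arg_cong[OF assoc_inverse(2), of dag3]
    by simp_all
  show "counit_left \<epsilon> (comult_dag a) = a" "counit_right \<epsilon> (comult_dag a) = a" for a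
    by (simp_all add: comult_dag_def counit_left_dag counit_right_dag counit_comult)
  have "tensor_map id (counit_left \<epsilon>) (\<Phi> * \<Psi>) = tensor_map id (counit_left \<epsilon>) \<Psi>"
    by (subst tensor_map_mult) (simp_all add: counit_middle)
  moreover have "tensor_map id (counit_left \<epsilon>) (dag3 t) =
      dag2 (tensor_map id (counit_left \<epsilon>) t)" for t
    by (rule additive_tensor_eqI[of "\<lambda>t. tensor_map id (counit_left \<epsilon>) (dag3 t)"])
      (simp_all add: counit_left_dag)
  ultimately show "tensor_map id (counit_left \<epsilon>) (dag3 \<Psi>) = 1"
    by (simp add: assoc_inverse)
  fix a
  let ?b = "\<Delta> (dag a)"
  have "\<Psi> * (tensor_assoc (tensor_map \<Delta> id ?b) * \<Phi>) * \<Psi> =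
      \<Psi> * (\<Phi> * tensor_map id \<Delta> ?b) * \<Psi>"
    by (simp only: quasi_coassoc)
  then have "\<Psi> * tensor_assoc (tensor_map \<Delta> id ?b) * (\<Phi> * \<Psi>) =
      (\<Psi> * \<Phi>) * tensor_map id \<Delta> ?b * \<Psi>"
    by (simp only: mult.assoc)
  then have "dag3 (\<Psi> * tensor_assoc (tensor_map \<Delta> id ?b)) = dag3 (tensor_map id \<Delta> ?b * \<Psi>)"
    by (simp add: assoc_inverse)
  then show "dag3 \<Psi> * tensor_map id comult_dag (comult_dag a) =
      tensor_assoc (tensor_map comult_dag id (comult_dag a)) * dag3 \<Psi>"
    by (simp only: comult_dag_def[of a] left2 right2 conj(3)[THEN conjugation_simps(3)])
qed (rule counit_hom comult_dag_hom)+

end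

locale conjugated_quasi_antipode =
  quasi_antipode \<epsilon> \<Delta> \<Phi> \<Psi> S \<alpha> \<beta> + conjugated_comultiplication \<epsilon> \<Delta> dag
  for \<epsilon> :: "'a::complex_algebra_1 \<Rightarrow> complex" and \<Delta> \<Phi> \<Psi> S \<alpha> \<beta> dag +
  assumes bij: "bij S"
begin

lemma inv_simps [simp]:
  "S (inv S a) = a" "inv S (S a) = a" "inv S 1 = 1" "inv S (a * b) = inv S b * inv S a"
  "inv S (a + b) = inv S a + inv S b" "inv S (c *\<^sub>C a) = c *\<^sub>C inv S a"
proof -
  show S_inv: "S (inv S a) = a" for a
    using bij by (simp add: bij_is_surj surj_f_inv_f)
  have inv_eqI: "inv S x = y" if "S y = x" for x y
    using that bij by (simp add: bij_is_inj inv_f_eq)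
  show "inv S (S a) = a" "inv S 1 = 1" "inv S (a * b) = inv S b * inv S a"
    "inv S (a + b) = inv S a + inv S b" "inv S (c *\<^sub>C a) = c *\<^sub>C inv S a"
    by (rule inv_eqI, simp add: S_inv)+
qed

abbreviation St :: "'a \<Rightarrow> 'a" where
  "St \<equiv> conj_antipode S dag"

lemma conj_antipode_antihom: "algebra_antihom St"
  by (auto simp: algebra_antihom_def conj_antipode_def intro!: clinearI)

lemma conj_antipode_simps [simp]:
  "St (dag a) = dag (inv S a)" "clinear St"
  using conj_antipode_antihom by (simp_all add: conj_antipode_def algebra_antihom_def)

lemma bij_conj_antipode: "bij St"
proof (rule o_bij)
  show "St \<circ> (\<lambda>a. dag (S (dag a))) = id" "(\<lambda>a. dag (S (dag a))) \<circ> St = id"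
    by (auto simp: conj_antipode_def)
qed

text \<open>The order reversal is compensated by the anti-homomorphism \<open>inv S\<close>, but \<open>\<alpha>\<close> and \<open>\<beta>\<close> change places:
  each antipode axiom is the image of the opposite one for \<open>S\<close> under \<open>inv S\<close> followed by conjugation.\<close>

theorem quasi_antipode_dag:
  "quasi_antipode \<epsilon> comult_dag (dag3 \<Psi>) (dag3 \<Phi>) St (dag (inv S \<beta>)) (dag (inv S \<alpha>))"
proof
  have "snake St (dag (inv S \<beta>)) (dag (inv S \<alpha>)) St (dag3 t) = dag (inv S (cosnake \<beta> S \<alpha> t))"
    for t
    by (rule additive_tensor3_eqI[of
          "\<lambda>t. snake St (dag (inv S \<beta>)) (dag (inv S \<alpha>)) St (dag3 t)"])
      (simp_all add: mult.assoc)
  then show "snake St (dag (inv S \<beta>)) (dag (inv S \<alpha>)) St (dag3 \<Psi>) = 1"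
    by (simp add: cosnake)
  have "cosnake (dag (inv S \<alpha>)) St (dag (inv S \<beta>)) (dag3 t) = dag (inv S (snake S \<alpha> \<beta> S t))"
    for t
    by (rule additive_tensor3_eqI[of
          "\<lambda>t. cosnake (dag (inv S \<alpha>)) St (dag (inv S \<beta>)) (dag3 t)"])
      (simp_all add: mult.assoc)
  then show "cosnake (dag (inv S \<alpha>)) St (dag (inv S \<beta>)) (dag3 \<Phi>) = 1"
    by (simp add: snake)
  have eval: "eval_pair St (dag (inv S \<beta>)) (dag2 t) = dag (inv S (coeval_pair \<beta> S t))" for t
    by (rule additive_tensor_eqI[of "\<lambda>t. eval_pair St (dag (inv S \<beta>)) (dag2 t)"])
      (simp_all add: mult.assoc)
  have coeval: "coeval_pair (dag (inv S \<alpha>)) St (dag2 t) = dag (inv S (eval_pair S \<alpha> t))" for t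
    by (rule additive_tensor_eqI[of "\<lambda>t. coeval_pair (dag (inv S \<alpha>)) St (dag2 t)"])
      (simp_all add: mult.assoc)
  fix a
  show "eval_pair St (dag (inv S \<beta>)) (comult_dag a) = \<epsilon> a *\<^sub>C dag (inv S \<beta>)"
    by (simp add: comult_dag_def eval coeval_comult counit_dag)
  show "coeval_pair (dag (inv S \<alpha>)) St (comult_dag a) = \<epsilon> a *\<^sub>C dag (inv S \<alpha>)"
    by (simp add: comult_dag_def coeval eval_comult counit_dag)
qed (rule counit_hom comult_dag_hom conj_antipode_antihom)+

end

section \<open>The canonical intertwiner of a quasi-Hopf star algebra\<close>

lemma tensor_lift3_eq_snake: "tensor_lift3 (\<lambda>x y z. S x * \<alpha> * y * \<beta> * S z) = snake S \<alpha> \<beta> S"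
  and tensor_lift3_eq_cosnake: "tensor_lift3 (\<lambda>x y z. x * \<beta> * S y * \<alpha> * z) = cosnake \<beta> S \<alpha>"
  and tensor_lift_eq_eval_pair: "tensor_lift (\<lambda>x y. S x * \<alpha> * y) = eval_pair S \<alpha>"
  and tensor_lift_eq_coeval_pair: "tensor_lift (\<lambda>x y. x * \<beta> * S y) = coeval_pair \<beta> S"
  by (simp_all add: snake_def cosnake_def eval_pair_def coeval_pair_def)

sublocale quasi_hopf_algebra \<subseteq> quasi_antipode \<epsilon> \<Delta> \<Phi> "inverse_of \<Phi>" S \<alpha> \<beta>
  using counit_hom comult_hom antipode_antihom antipode_coassociator antipode_left antipode_right
  by unfold_locales (simp_all only: tensor_lift3_eq_snake tensor_lift3_eq_cosnake
      tensor_lift_eq_eval_pair tensor_lift_eq_coeval_pair)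

sublocale quasi_hopf_algebra \<subseteq> quasi_bialgebra \<epsilon> \<Delta> \<Phi> "inverse_of \<Phi>"
proof
  note inv = has_inverse[OF coassociator_invertible]
  then show "\<Phi> * inverse_of \<Phi> = 1" "inverse_of \<Phi> * \<Phi> = 1"
    by simp_all
  show "\<Phi> * tensor_map id \<Delta> (\<Delta> a) = tensor_assoc (tensor_map \<Delta> id (\<Delta> a)) * \<Phi>" for a
    unfolding quasi_coassoc mult.assoc[symmetric] inv mult_1_left ..
qed (rule counit_comult pentagon counit_coassociator)+

sublocale quasi_hopf_star_algebra \<subseteq> conjugated_quasi_bialgebra \<epsilon> \<Delta> \<Phi> "inverse_of \<Phi>" dag
  by unfold_locales (rule conjugation counit_dag)+

sublocale quasi_hopf_star_algebra \<subseteq> conjugated_quasi_antipode \<epsilon> \<Delta> \<Phi> "inverse_of \<Phi>" S \<alpha> \<beta> dag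
  by unfold_locales (rule antipode_bij)

lemma twist_alpha_eq_eval_pair: "clinear S \<Longrightarrow> twist_alpha S \<alpha> F = eval_pair S \<alpha> (inverse_of F)"
  unfolding twist_alpha_def
  by (rule additive_tensor_eqI[of "\<lambda>t. mult_map ((1 \<otimes> \<alpha>) * tensor_map S id t)"])
    (simp_all add: distrib_left mult.assoc mult_map_add)

lemma twist_beta_eq_coeval_pair: "clinear S \<Longrightarrow> twist_beta S \<beta> F = coeval_pair \<beta> S F"
  unfolding twist_beta_def
  by (rule additive_tensor_eqI[of "\<lambda>t. mult_map ((1 \<otimes> \<beta>) * tensor_map id S t)"])
    (simp_all add: distrib_left mult.assoc mult_map_add)

context quasi_hopf_star_algebra
begin

abbreviation \<Phi>\<^sub>d :: "'a \<otimes> 'a \<otimes> 'a" where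
  "\<Phi>\<^sub>d \<equiv> dag3 (inverse_of \<Phi>)"

abbreviation \<Psi>\<^sub>d :: "'a \<otimes> 'a \<otimes> 'a" where
  "\<Psi>\<^sub>d \<equiv> dag3 \<Phi>"

text \<open>The axioms on the canonical element say precisely that twisting by it and conjugating give the
  same comultiplication and co-associator, so the twisted antipode data live on the conjugate
  quasi-bialgebra as well.\<close>

lemma quasi_antipode_canonical_twist:
  "quasi_antipode \<epsilon> comult_dag \<Phi>\<^sub>d \<Psi>\<^sub>d S (twist_alpha S \<alpha> \<Omega>) (twist_beta S \<beta> \<Omega>)"
proof -
  let ?G = "inverse_of \<Omega>"
  have inv: "\<Omega> * ?G = 1" "?G * \<Omega> = 1"
    and counit: "counit_left \<epsilon> \<Omega> = 1" "counit_right \<epsilon> \<Omega> = 1"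
    using canonical_twist has_inverse[of \<Omega>] by (auto simp: is_twist_def)
  have dag_inv: "dag3 (inverse_of \<Phi>) * dag3 \<Phi> = 1" "dag3 \<Phi> * dag3 (inverse_of \<Phi>) = 1"
    using quasi_bialgebra.assoc_inverse[OF quasi_bialgebra_dag] by simp_all
  have comult: "comult_dag = (\<lambda>a. \<Omega> * \<Delta> a * ?G)"
    by (rule ext) (simp add: comult_dag_def comult_dag)
  have "\<Phi>\<^sub>d = twist_coassociator \<Delta> \<Phi> \<Omega>"
    using coassociator_dag inverse_of_eqI[OF dag_inv(2,1)] by simp
  then have Phi: "\<Phi>\<^sub>d = tensor_assoc (\<Omega> \<otimes> 1) * tensor_assoc (tensor_map \<Delta> id \<Omega>) * \<Phi> *
      tensor_map id \<Delta> ?G * (1 \<otimes> ?G)"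
    by (simp only: twist_coassociator_def)
  let ?Q = "(1 \<otimes> \<Omega>) * tensor_map id \<Delta> \<Omega> * inverse_of \<Phi> * tensor_assoc (tensor_map \<Delta> id ?G) *
      tensor_assoc (?G \<otimes> 1)"
  have homs: "algebra_hom (tensor_map id \<Delta> :: 'a \<otimes> 'a \<Rightarrow> _)"
    "algebra_hom (\<lambda>t :: 'a \<otimes> 'a. tensor_assoc (tensor_map \<Delta> id t))"
    by (rule algebra_hom_tensor_map[OF algebra_hom_id comult_hom]
        algebra_hom_compose[OF algebra_hom_tensor_assoc
          algebra_hom_tensor_map[OF comult_hom algebra_hom_id]])+
  have units: "algebra_hom (\<lambda>t :: 'a \<otimes> 'a. (1::'a) \<otimes> t)"
    "algebra_hom (\<lambda>t :: 'a \<otimes> 'a. tensor_assoc (t \<otimes> (1::'a)))"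
    by (rule algebra_hom_unit_tensor(1)
        algebra_hom_compose[OF algebra_hom_tensor_assoc algebra_hom_unit_tensor(2)])+
  have cancel: "f \<Omega> * f ?G = 1" "f ?G * f \<Omega> = 1" "f \<Omega> * (f ?G * t) = t"
    "f ?G * (f \<Omega> * t) = t" if "algebra_hom f"
    for f :: "'a \<otimes> 'a \<Rightarrow> 'a \<otimes> 'a \<otimes> 'a" and t
    using arg_cong[OF inv(1), of f] arg_cong[OF inv(2), of f] that
    by (simp_all add: algebra_hom_def mult.assoc[symmetric])
  have cancel_assoc: "\<Phi> * (inverse_of \<Phi> * t) = t" for t
    by (simp add: assoc_inverse mult.assoc[symmetric])
  have "\<Phi>\<^sub>d * ?Q = 1"
    unfolding Phi by (simp only: mult.assoc cancel_assoc cancel[OF homs(1)] cancel[OF homs(2)]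
        cancel[OF units(1)] cancel[OF units(2)])
  then have "\<Psi>\<^sub>d * (\<Phi>\<^sub>d * ?Q) = \<Psi>\<^sub>d"
    by (simp only: mult_1_right)
  then have Psi: "\<Psi>\<^sub>d = ?Q"
    by (simp only: mult.assoc[symmetric, of "\<Psi>\<^sub>d"] dag_inv mult_1_left)
  show ?thesis
    unfolding comult Psi Phi twist_alpha_eq_eval_pair[OF antipode_simps(1)]
      twist_beta_eq_coeval_pair[OF antipode_simps(1)]
    by (rule quasi_antipode_twist[OF inv counit])
qed

end

theorem proposition5:
  fixes \<epsilon> :: "'a::complex_algebra_1 \<Rightarrow> complex"
    and \<Delta> :: "'a \<Rightarrow> 'a \<otimes> 'a"
    and \<Phi> :: "'a \<otimes> 'a \<otimes> 'a"
    and S :: "'a \<Rightarrow> 'a"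
    and \<alpha> \<beta> :: 'a
    and dag :: "'a \<Rightarrow> 'a"
    and \<Omega> :: "'a \<otimes> 'a"
    and St :: "'a \<Rightarrow> 'a"
    and \<alpha>\<^sub>\<Omega> \<beta>\<^sub>\<Omega> :: 'a
    and I :: "'i set" and X Y Z :: "'i \<Rightarrow> 'a"
    and J :: "'j set" and Xb Yb Zb :: "'j \<Rightarrow> 'a"
  assumes H: "quasi_hopf_star_algebra \<epsilon> \<Delta> \<Phi> S \<alpha> \<beta> dag \<Omega>"
    and St: "St = conj_antipode S dag"
    and alpha: "\<alpha>\<^sub>\<Omega> = twist_alpha S \<alpha> \<Omega>"
    and beta: "\<beta>\<^sub>\<Omega> = twist_beta S \<beta> \<Omega>"
    and Phi: "finite I" "\<Phi> = (\<Sum>\<nu>\<in>I. X \<nu> \<otimes> Y \<nu> \<otimes> Z \<nu>)"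
    and Phi_inv: "finite J" "inverse_of \<Phi> = (\<Sum>\<nu>\<in>J. Xb \<nu> \<otimes> Yb \<nu> \<otimes> Zb \<nu>)"
  shows "let P = (\<lambda>w. has_inverse w \<and>
            w * dag (inv S \<beta>) = \<alpha>\<^sub>\<Omega> \<and> \<beta>\<^sub>\<Omega> * w = dag (inv S \<alpha>) \<and>
            (\<forall>a. S a = w * St a * inverse_of w))
    in (\<exists>!w. P w) \<and>
       (\<forall>w. P w \<longrightarrow>
          w = (\<Sum>\<nu>\<in>J. S (dag (Xb \<nu>)) * \<alpha>\<^sub>\<Omega> * dag (Yb \<nu>) * dag (inv S \<alpha>) * St (dag (Zb \<nu>))) \<and>
          w = (\<Sum>\<nu>\<in>I. S (inv St (dag (X \<nu>))) * S (inv St (dag (inv S \<alpha>))) *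
                 S (dag (Y \<nu>)) * \<alpha>\<^sub>\<Omega> * dag (Z \<nu>)) \<and>
          inverse_of w = (\<Sum>\<nu>\<in>J. St (dag (Xb \<nu>)) * dag (inv S \<beta>) * dag (Yb \<nu>) * \<beta>\<^sub>\<Omega> *
                 S (dag (Zb \<nu>))) \<and>
          inverse_of w = (\<Sum>\<nu>\<in>I. dag (X \<nu>) * \<beta>\<^sub>\<Omega> * S (dag (Y \<nu>)) *
                 S (inv St (dag (inv S \<beta>))) * S (inv St (dag (Z \<nu>)))))"
proof -
  interpret quasi_hopf_star_algebra \<epsilon> \<Delta> \<Phi> S \<alpha> \<beta> dag \<Omega>
    by (rule H)
  let ?\<gamma> = "dag (inv S \<beta>)" and ?\<delta> = "dag (inv S \<alpha>)"
  interpret D: quasi_bialgebra_two_antipodes \<epsilon> comult_dag \<Phi>\<^sub>d \<Psi>\<^sub>d S \<alpha>\<^sub>\<Omega> \<beta>\<^sub>\<Omega> St ?\<gamma> ?\<delta>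
    unfolding quasi_bialgebra_two_antipodes_def two_quasi_antipodes_def alpha beta St
    using quasi_bialgebra_dag quasi_antipode_canonical_twist quasi_antipode_dag by blast
  interpret D': quasi_bialgebra_two_antipodes \<epsilon> comult_dag \<Phi>\<^sub>d \<Psi>\<^sub>d St ?\<gamma> ?\<delta> S \<alpha>\<^sub>\<Omega> \<beta>\<^sub>\<Omega>
    by (rule two_quasi_antipodes_swap) (rule D.quasi_bialgebra_two_antipodes_axioms)
  have "dag3 (\<Sum>i\<in>K. x i \<otimes> y i \<otimes> z i) = (\<Sum>i\<in>K. dag (x i) \<otimes> dag (y i) \<otimes> dag (z i))"
    for K :: "'k set" and x y z
    by (subst additive_sum_eq[of dag3]) simp_all
  note dag_sums = this[of Xb Yb Zb J, folded Phi_inv(2)] this[of X Y Z I, folded Phi(2)]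
  have surj: "surj St"
    unfolding St by (rule bij_is_surj) (rule bij_conj_antipode)
  define P where "P = antipode_intertwiner S \<alpha>\<^sub>\<Omega> \<beta>\<^sub>\<Omega> St ?\<gamma> ?\<delta>"
  have "\<exists>!w. P w"
    unfolding P_def
    by (rule ex1I) (rule D.antipode_intertwiner_snake D.antipode_intertwiner_unique, assumption?)+
  moreover have "\<forall>w. P w \<longrightarrow>
      w = (\<Sum>\<nu>\<in>J. S (dag (Xb \<nu>)) * \<alpha>\<^sub>\<Omega> * dag (Yb \<nu>) * ?\<delta> * St (dag (Zb \<nu>))) \<and>
      w = (\<Sum>\<nu>\<in>I. S (inv St (dag (X \<nu>))) * S (inv St ?\<delta>) * S (dag (Y \<nu>)) * \<alpha>\<^sub>\<Omega> * dag (Z \<nu>)) \<and>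
      inverse_of w = (\<Sum>\<nu>\<in>J. St (dag (Xb \<nu>)) * ?\<gamma> * dag (Yb \<nu>) * \<beta>\<^sub>\<Omega> * S (dag (Zb \<nu>))) \<and>
      inverse_of w = (\<Sum>\<nu>\<in>I. dag (X \<nu>) * \<beta>\<^sub>\<Omega> * S (dag (Y \<nu>)) * S (inv St ?\<gamma>) *
        S (inv St (dag (Z \<nu>))))"
  proof (intro allI impI)
    fix w
    assume "P w"
    then show "w = (\<Sum>\<nu>\<in>J. S (dag (Xb \<nu>)) * \<alpha>\<^sub>\<Omega> * dag (Yb \<nu>) * ?\<delta> * St (dag (Zb \<nu>))) \<and>
      w = (\<Sum>\<nu>\<in>I. S (inv St (dag (X \<nu>))) * S (inv St ?\<delta>) * S (dag (Y \<nu>)) * \<alpha>\<^sub>\<Omega> * dag (Z \<nu>)) \<and>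
      inverse_of w = (\<Sum>\<nu>\<in>J. St (dag (Xb \<nu>)) * ?\<gamma> * dag (Yb \<nu>) * \<beta>\<^sub>\<Omega> * S (dag (Zb \<nu>))) \<and>
      inverse_of w = (\<Sum>\<nu>\<in>I. dag (X \<nu>) * \<beta>\<^sub>\<Omega> * S (dag (Y \<nu>)) * S (inv St ?\<gamma>) *
        S (inv St (dag (Z \<nu>))))"
      using D.antipode_intertwiner_unique[of w, unfolded dag_sums(1) D.snake_sum]
        D.antipode_intertwiner_inverse[of w, unfolded dag_sums(1) D'.snake_sum]
        D.antipode_intertwiner_cosnake[of w, OF _ surj dag_sums(2)]
      unfolding P_def by blast
  qed
  ultimately show ?thesis
    unfolding P_def antipode_intertwiner_def Let_def by (rule conjI)
qed

end
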